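(* Let $I=[a,b]\subset\mathbb{R}$ be a closed interval and let $f:I\to I$ be a continuous map with zero topological entropy. Then the flow $\mathcal{X}=\{f^n: I\to I\}_{n\in\{0\}\cup\mathbb{N}}$ generated by $f$ is minimally mean-attractable (MMA) and minimally mean-L-stable (MMLS).
   Context: Here $\mathbb{N}=\{1,2,3,\dots\}$. For a compact metric space $(X,d)$ and a continuous map $f:X\to X$, the flow generated by $f$ is $\mathcal{X}=\{f^n:X\to X\}_{n\in\{0\}\cup\mathbb{N}}$, where $f^n$ is the $n$-th iterate and $f^0$ is the identity. In the case $X=I$, the metric is $d(x,y)=|x-y|$. The upper density of $E\subset\mathbb{N}$ is $\overline{D}(E)=\limsup_{N\to\infty}\frac{\#(E\cap[1,N])}{N}$. Mean-L-stable (MLS): the flow $\mathcal{X}$ is MLS if for every $\epsilon>0$ there is $\delta>0$ such that $d(x,y)<\delta$ implies $d(f^nx,f^ny)<\epsilon$ for all $n\in\mathbb{N}$ except for $n$ in a subset $E\subset\mathbb{N}$ (which may depend on $x,y$) with $\overline{D}(E)<\epsilon$. Minimal subset: a closed subset $K\subset X$ is minimal (with respect to $f$) if $f(K)\subset K$ and $\overline{\{f^nx : n\in\mathbb{N}\}}=K$ for every $x\in K$. The corresponding sub-flow is $\mathcal{K}=\{(f|K)^n:K\to K\}_{n\in\{0\}\cup\mathbb{N}}$. Minimally mean-L-stable (MMLS): $\mathcal{X}$ is MMLS if for every minimal subset $K\subseteq X$ the sub-flow $\mathcal{K}$ is MLS. Minimally mean-attractable (MMA): let $K\subset X$ be minimal.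 A point $x\in X$ is mean-attracted to $K$ if for any $\epsilon>0$ there is a point $z=z_{\epsilon,x}\in K$ (depending on $x$ and $\epsilon$) such that $\limsup_{N\to\infty}\frac1N\sum_{n=1}^N d(f^nx,f^nz)<\epsilon$. The set of all points mean-attracted to $K$ is denoted $\mathrm{Basin}(K)$. The flow $\mathcal{X}$ is MMA if $X=\bigcup_K \mathrm{Basin}(K)$, where $K$ ranges over all minimal subsets of $X$. *)

theory Defs
  imports "HOL-Analysis.Analysis"
begin

text \<open>
  A flow is given by a set \<open>X\<close> (a compact subset of a metric space) and a function \<open>f\<close> that is
  continuous on \<open>X\<close> and maps \<open>X\<close> into itself. The values of \<open>f\<close> outside \<open>X\<close> play no role, so the
  sub-flow on an invariant set \<open>K\<close> is the pair of \<open>K\<close> and the same \<open>f\<close>. Times range over the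
  positive integers.
\<close>

definition upper_density :: "nat set \<Rightarrow> ereal" where
  "upper_density E = limsup (\<lambda>N. ereal (real (card (E \<inter> {1..N})) / real N))"

definition mean_L_stable :: "'a::metric_space set \<Rightarrow> ('a \<Rightarrow> 'a) \<Rightarrow> bool" where
  "mean_L_stable X f \<longleftrightarrow>
    (\<forall>\<epsilon>>0. \<exists>\<delta>>0. \<forall>x\<in>X. \<forall>y\<in>X. dist x y < \<delta> \<longrightarrow>
      (\<exists>E. E \<subseteq> {1..} \<and> upper_density E < ereal \<epsilon> \<and>
        (\<forall>n\<in>{1..} - E. dist ((f ^^ n) x) ((f ^^ n) y) < \<epsilon>)))"

text \<open>
  Since \<open>X\<close> is compact, being closed in \<open>X\<close> and closure in \<open>X\<close> agree with the ambient notions.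
  The empty set satisfies this definition; it is trivially mean-L-stable and has empty basin, so
  it affects neither of the two properties below that quantify over minimal subsets.
\<close>

definition minimal_subset :: "'a::metric_space set \<Rightarrow> ('a \<Rightarrow> 'a) \<Rightarrow> 'a set \<Rightarrow> bool" where
  "minimal_subset X f K \<longleftrightarrow>
    K \<subseteq> X \<and> closed K \<and> f ` K \<subseteq> K \<and> (\<forall>x\<in>K. closure {(f ^^ n) x |n. n \<ge> 1} = K)"

definition minimally_mean_L_stable :: "'a::metric_space set \<Rightarrow> ('a \<Rightarrow> 'a) \<Rightarrow> bool" where
  "minimally_mean_L_stable X f \<longleftrightarrow> (\<forall>K. minimal_subset X f K \<longrightarrow> mean_L_stable K f)"

definition mean_attracted :: "('a::metric_space \<Rightarrow> 'a) \<Rightarrow> 'a set \<Rightarrow> 'a \<Rightarrow> bool" where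
  "mean_attracted f K x \<longleftrightarrow>
    (\<forall>\<epsilon>>0. \<exists>z\<in>K.
      limsup (\<lambda>N. ereal ((\<Sum>n=1..N. dist ((f ^^ n) x) ((f ^^ n) z)) / real N)) < ereal \<epsilon>)"

definition basin :: "'a::metric_space set \<Rightarrow> ('a \<Rightarrow> 'a) \<Rightarrow> 'a set \<Rightarrow> 'a set" where
  "basin X f K = {x \<in> X. mean_attracted f K x}"

definition minimally_mean_attractable :: "'a::metric_space set \<Rightarrow> ('a \<Rightarrow> 'a) \<Rightarrow> bool" where
  "minimally_mean_attractable X f \<longleftrightarrow> X = (\<Union>K\<in>{K. minimal_subset X f K}. basin X f K)"

text \<open>
  Topological entropy in Bowen's form, by \<open>(n, \<epsilon>)\<close>-separated sets. The logarithm is taken inside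
  the supremum over separated sets, which for compact \<open>X\<close> is the logarithm of the maximal
  cardinality. The limit as \<open>\<epsilon>\<close> tends to 0 is a supremum by monotonicity.
\<close>

definition separated_sets ::
  "'a::metric_space set \<Rightarrow> ('a \<Rightarrow> 'a) \<Rightarrow> nat \<Rightarrow> real \<Rightarrow> 'a set set" where
  "separated_sets X f n \<epsilon> =
    {E. finite E \<and> E \<subseteq> X \<and>
        (\<forall>x\<in>E. \<forall>y\<in>E. x \<noteq> y \<longrightarrow> (\<exists>k<n. dist ((f ^^ k) x) ((f ^^ k) y) > \<epsilon>))}"

definition topological_entropy :: "'a::metric_space set \<Rightarrow> ('a \<Rightarrow> 'a) \<Rightarrow> ereal" where
  "topological_entropy X f =
    (SUP \<epsilon>\<in>{0<..}. limsup (\<lambda>n. SUP E\<in>separated_sets X f n \<epsilon>.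
        ereal (ln (real (card E)) / real n)))"

end

theory Submission imports Defs begin

text \<open>
  Zero entropy excludes horseshoes for all iterates of \<open>f\<close>. Without horseshoes, an orbit with an
  infinite \<open>\<omega>\<close>-limit set has a fixed point \<open>z\<close> such that it moves up on the left and down on the
  right of \<open>z\<close>. If it failed to alternate sides infinitely often, then from some time on it would
  stay on the inner side of any given one of its points, and the limit set would have at most two
  points. So the orbit finally alternates, and \<open>z\<close> separates the two limit sets under \<open>f\<^sup>2\<close>. Iterating this with
  \<open>f\<^sup>2, f\<^sup>4, \<dots>\<close> splits the limit set into \<open>2\<^sup>n\<close> cyclically permuted pieces with nonoverlapping
  convex hulls, of total length at most \<open>b - a\<close>. Two orbits that visit the pieces in step
  therefore have mean distance at most \<open>(b - a) / 2\<^sup>n\<close>. An infinite minimal set contains no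
  periodic point, so its pieces are disjoint and nearby points start in the same piece.
\<close>

section \<open>Horseshoes of interval maps\<close>

text \<open>Nothing forces every single piece of the tower to become short; only the total length of
  the hulls is controlled. This is why both conclusions concern averages and densities: the times
  are spread evenly over the \<open>2 ^ n\<close> pieces, so a few long ones weigh little. The point
  separating two halves may be a limit of both, so neighbouring pieces may touch. Mean attraction
  tolerates this, because the companion point is chosen to start in the right piece; stability
  compares arbitrary nearby points and needs a positive gap. The splitting needs an infinite limit
  set; an orbit with a finite one is shadowed by an orbit inside a minimal subset of it.\<close>

locale interval_map =
  fixes a b :: real and f :: "real \<Rightarrow> real"
  assumes cont: "continuous_on {a..b} f" and maps: "f ` {a..b} \<subseteq> {a..b}"
begin

lemma f_in: "x \<in> {a..b} \<Longrightarrow> f x \<in> {a..b}"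
  using maps by blast

lemma funpow_in: "x \<in> {a..b} \<Longrightarrow> (f ^^ n) x \<in> {a..b}"
proof (induction n)
  case (Suc n)
  then show ?case using f_in[of "(f ^^ n) x"] by simp
qed simp

lemma continuous_funpow: "continuous_on {a..b} (f ^^ n)"
proof (induction n)
  case (Suc n)
  have "continuous_on ((f ^^ n) ` {a..b}) f"
    using continuous_on_subset[OF cont] funpow_in by blast
  then show ?case using continuous_on_compose[OF Suc] by simp
qed simp

lemma interval_map_funpow: "interval_map a b (f ^^ n)"
  using continuous_funpow funpow_in by unfold_locales auto

lemma segment_in: "x \<in> {a..b} \<Longrightarrow> y \<in> {a..b} \<Longrightarrow> closed_segment x y \<subseteq> {a..b}"
  by (rule closed_segment_subset) (auto simp: convex_real_interval)

lemma segment_image: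
  assumes "x \<in> {a..b}" "y \<in> {a..b}"
  shows "closed_segment (f x) (f y) \<subseteq> f ` closed_segment x y"
proof -
  have "connected (f ` closed_segment x y)"
    using continuous_on_subset[OF cont segment_in[OF assms]]
    by (intro connected_continuous_image) auto
  then show ?thesis
    by (intro closed_segment_subset) (auto simp: connected_convex_1)
qed

lemma fixed_point_between:
  assumes "s \<in> {a..b}" "t \<in> {a..b}" "s \<le> f s" "f t \<le> t"
  shows "\<exists>r\<in>closed_segment s t. f r = r"
proof -
  have "continuous_on (closed_segment s t) (\<lambda>x. f x - x)"
    by (intro continuous_intros continuous_on_subset[OF cont segment_in[OF assms(1,2)]])
  then have "connected ((\<lambda>x. f x - x) ` closed_segment s t)"
    by (intro connected_continuous_image) auto
  then have "0 \<in> (\<lambda>x. f x - x) ` closed_segment s t"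
    by (rule connectedD_interval[of _ "f t - t" "f s - s"]) (use assms in auto)
  then show ?thesis by force
qed

end

lemma segment_funpow_image:
  assumes "interval_map a b f" "x \<in> {a..b}" "y \<in> {a..b}"
  shows "closed_segment ((f ^^ n) x) ((f ^^ n) y) \<subseteq> (f ^^ n) ` closed_segment x y"
  by (rule interval_map.segment_image[OF interval_map.interval_map_funpow]) (use assms in auto)

text \<open>The two halves share the point \<open>c\<close>; the closed segments leave the order of \<open>p\<close> and \<open>q\<close> open.\<close>

definition horseshoe :: "real \<Rightarrow> real \<Rightarrow> (real \<Rightarrow> real) \<Rightarrow> bool" where
  "horseshoe a b g \<longleftrightarrow> (\<exists>p\<in>{a..b}. \<exists>q\<in>{a..b}. \<exists>c\<in>open_segment p q.
     closed_segment p q \<subseteq> g ` closed_segment p c \<and> closed_segment p q \<subseteq> g ` closed_segment c q)"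

text \<open>All iterates are included so that the property passes to \<open>f ^^ (2 ^ n)\<close>,
  where the splitting of limit sets is repeated.\<close>

definition horseshoe_free :: "real \<Rightarrow> real \<Rightarrow> (real \<Rightarrow> real) \<Rightarrow> bool" where
  "horseshoe_free a b f \<longleftrightarrow> (\<forall>k\<ge>1. \<not> horseshoe a b (f ^^ k))"

lemma horseshoe_free_funpow:
  assumes "horseshoe_free a b f" "n \<ge> 1" shows "horseshoe_free a b (f ^^ n)"
  using assms by (simp add: horseshoe_free_def funpow_mult)

section \<open>Reflection of the line\<close>

lemma funpow_mirror: "((\<lambda>x. - f (- x)) ^^ n) x = - (f ^^ n) (- x)" for f :: "real \<Rightarrow> real"
  by (induction n) auto

lemma interval_map_mirror:
  assumes "interval_map a b f" shows "interval_map (- b) (- a) (\<lambda>x. - f (- x))"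
proof -
  interpret interval_map a b f by fact
  have "continuous_on {- b..- a} (\<lambda>x. - f (- x))"
    by (intro continuous_intros continuous_on_compose2[OF cont]) auto
  then show ?thesis using f_in by unfold_locales auto
qed

lemma closed_segment_uminus: "closed_segment (- x) (- y) = uminus ` closed_segment x y" for x y :: real
  by (auto simp: closed_segment_eq_real_ivl image_iff intro!: bexI[where x = "- _"])

lemma open_segment_uminus: "open_segment (- x) (- y) = uminus ` open_segment x y" for x y :: real
  unfolding open_segment_def closed_segment_uminus by auto

lemma horseshoe_mirror:
  assumes "horseshoe (- b) (- a) (\<lambda>x. - g (- x))" shows "horseshoe a b g"
proof -
  obtain p q c where *: "p \<in> {- b..- a}" "q \<in> {- b..- a}" "c \<in> open_segment p q"
    "closed_segment p q \<subseteq> (\<lambda>x. - g (- x)) ` closed_segment p c"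
    "closed_segment p q \<subseteq> (\<lambda>x. - g (- x)) ` closed_segment c q"
    using assms by (auto simp: horseshoe_def)
  have cover: "closed_segment (- p) (- q) \<subseteq> g ` closed_segment (- s) (- t)"
    if "closed_segment p q \<subseteq> (\<lambda>x. - g (- x)) ` closed_segment s t" for s t
    using that unfolding closed_segment_uminus by force
  show ?thesis unfolding horseshoe_def
    by (rule bexI[where x = "- p"], rule bexI[where x = "- q"], rule bexI[where x = "- c"])
      (use * cover open_segment_uminus in auto)
qed

text \<open>The reflection reverses the order, so a one-sided horseshoe criterion has to be proved
  in one orientation only.\<close>

lemma horseshoe_free_mirror:
  assumes "horseshoe_free a b f" shows "horseshoe_free (- b) (- a) (\<lambda>x. - f (- x))"
proof -
  have "(\<lambda>x. - f (- x)) ^^ k = (\<lambda>x. - (f ^^ k) (- x))" for k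
    by (simp add: fun_eq_iff funpow_mirror)
  then show ?thesis using assms horseshoe_mirror by (force simp: horseshoe_free_def)
qed

context interval_map
begin

text \<open>
  With \<open>p\<close> and \<open>z\<close> the fixed points next to \<open>d\<close>, the orbit of \<open>d\<close> can only pass \<open>z\<close> from a
  point \<open>q < p\<close>. The iterate that carries \<open>d\<close> to \<open>f q\<close> fixes \<open>p\<close> and \<open>z\<close>, and both halves
  \<open>[p, d]\<close> and \<open>[d, z]\<close> are stretched over \<open>[q, p]\<close> one step earlier.
\<close>

lemma horseshoe_if_down_then_up:
  assumes d: "d \<in> {a..b}" and down: "f d < d" and up: "(f ^^ m) d < f ((f ^^ m) d)"
    and less: "d < (f ^^ m) d"
  shows "\<exists>k\<ge>1. horseshoe a b (f ^^ k)"
proof -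
  let ?e = "(f ^^ m) d"
  have e: "?e \<in> {a..b}" using d by (rule funpow_in)
  \<comment> \<open>Compactness yields a largest fixed point below \<open>d\<close> and a smallest
    one above it, with no fixed point strictly between them.\<close>
  have fix_closed: "compact {t \<in> S. f t = t}" if "compact S" "S \<subseteq> {a..b}" for S
  proof -
    have "closed {t \<in> S. f t - t = 0}"
      by (intro continuous_closed_preimage_constant continuous_intros continuous_on_subset[OF cont])
        (use that compact_imp_closed in auto)
    then have "compact (S \<inter> {t \<in> S. f t - t = 0})" using that by (intro compact_Int_closed)
    then show ?thesis by (rule back_subst[of compact]) auto
  qed
  have "a \<in> {a..b}" using d by auto
  then have "\<exists>r\<in>closed_segment a d. f r = r"
    using fixed_point_between[of a d] d down f_in[of a] by auto
  then have "{t \<in> {a..d}. f t = t} \<noteq> {}" using d by (auto simp: closed_segment_eq_real_ivl)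
  then obtain p where p: "p \<in> {a..d}" "f p = p" and p_max: "\<And>t. t \<in> {a..d} \<Longrightarrow> f t = t \<Longrightarrow> t \<le> p"
    using compact_attains_sup[OF fix_closed[of "{a..d}"]] d by auto
  have "\<exists>r\<in>closed_segment ?e d. f r = r"
    by (rule fixed_point_between) (use d e up down in auto)
  then have "{t \<in> {d..?e}. f t = t} \<noteq> {}" using less by (auto simp: closed_segment_eq_real_ivl)
  then obtain z where z: "z \<in> {d..?e}" "f z = z" and z_min: "\<And>t. t \<in> {d..?e} \<Longrightarrow> f t = t \<Longrightarrow> z \<le> t"
    using compact_attains_inf[OF fix_closed[of "{d..?e}"]] d e by auto
  have pd: "p < d" and dz: "d < z" and ze: "z < ?e"
    using p z down up by (auto simp: less_le)
  have below: "f t < t" if t: "t \<in> {p<..<z}" for t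
  proof (rule ccontr)
    assume "\<not> f t < t"
    then obtain r where r: "r \<in> closed_segment t d" "f r = r"
      using fixed_point_between[of t d] t d p e z down by auto
    then have "r \<le> p \<or> z \<le> r" using p_max[of r] z_min[of r] t p ze dz
      by (auto simp: closed_segment_eq_real_ivl split: if_splits)
    then show False using r t pd dz by (auto simp: closed_segment_eq_real_ivl split: if_splits)
  qed
  \<comment> \<open>\<open>j\<close> is the first time at which the orbit reaches or passes
    \<open>z\<close>. Its predecessor \<open>q\<close> is left of \<open>z\<close> but is mapped to
    \<open>z\<close> or beyond, which \<open>below\<close> rules out between \<open>p\<close> and
    \<open>z\<close>.\<close>
  define j where "j = (LEAST j. z \<le> (f ^^ j) d)"
  have j: "z \<le> (f ^^ j) d" unfolding j_def by (rule LeastI[of _ m]) (use ze in simp)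
  have j_least: "(f ^^ i) d < z" if "i < j" for i
    using not_less_Least that unfolding j_def not_le[symmetric] by blast
  have "j \<noteq> 0" using j dz by (auto intro: gr0I)
  then obtain s where s: "j = Suc s" using not0_implies_Suc by blast
  define q where "q = (f ^^ s) d"
  have q: "q < z" "z \<le> f q" "q \<in> {a..b}"
    using j j_least[of s] s funpow_in[OF d] by (auto simp: q_def)
  have qp: "q < p" using below[of q] q(1,2) p(2) pd dz by (cases q p rule: linorder_cases) auto
  have pz_in: "p \<in> {a..b}" "z \<in> {a..b}" using p z d e by auto
  have fix_pow: "(f ^^ n) p = p" "(f ^^ n) z = z" for n using p z by (induction n) auto
  have "closed_segment p z \<subseteq> closed_segment (f q) (f p)"
    using q(2) p(2) pd dz by (auto simp: closed_segment_eq_real_ivl)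
  then have "closed_segment p z \<subseteq> f ` closed_segment q p"
    using segment_image[OF q(3) pz_in(1)] by (rule order_trans)
  moreover have "closed_segment q p \<subseteq> (f ^^ s) ` closed_segment p d"
    using segment_funpow_image[OF interval_map_axioms pz_in(1) d, of s] fix_pow(1)[of s]
    by (simp add: q_def closed_segment_commute)
  moreover have "closed_segment q p \<subseteq> (f ^^ s) ` closed_segment d z"
    using segment_funpow_image[OF interval_map_axioms d pz_in(2), of s] fix_pow(2)[of s] qp pd dz
    by (auto simp: q_def closed_segment_eq_real_ivl)
  ultimately have "closed_segment p z \<subseteq> f ` (f ^^ s) ` closed_segment p d"
    "closed_segment p z \<subseteq> f ` (f ^^ s) ` closed_segment d z"
    by (meson image_mono order_trans)+
  then have "closed_segment p z \<subseteq> (f ^^ Suc s) ` closed_segment p d"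
    "closed_segment p z \<subseteq> (f ^^ Suc s) ` closed_segment d z"
    by (simp_all add: image_image)
  moreover have "d \<in> open_segment p z" using pd dz by (auto simp: open_segment_eq_real_ivl)
  ultimately have "horseshoe a b (f ^^ Suc s)" unfolding horseshoe_def using pz_in by blast
  then show ?thesis by (intro exI[where x = "Suc s"]) simp
qed

text \<open>
  With \<open>J j = [u j, z]\<close> and \<open>n = m - k\<close>, the cyclic covering chain of the \<open>J j\<close> returns to \<open>J i\<close>
  after \<open>n\<close> steps. A preimage \<open>c\<close> of \<open>z\<close> between \<open>u i\<close> and \<open>u (i + 1)\<close> splits \<open>J i\<close> into
  \<open>A = [u i, c]\<close>, which follows the whole chain, and \<open>B = [c, z]\<close>, which covers \<open>J (i + 2)\<close> at once
  and so is one step faster. The common return time \<open>n (n - 1)\<close> gives a horseshoe.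
\<close>

lemma horseshoe_if_nonalternating_return:
  fixes u :: "nat \<Rightarrow> real"
  assumes u: "\<And>k. u k \<in> {a..b}" "\<And>k. u (Suc k) = f (u k)" "\<And>k. u k \<noteq> z"
    and z: "f z = z" "z \<in> {a..b}"
    and toward: "u (Suc i) \<in> closed_segment (u i) z"
    and return: "u k \<in> closed_segment (u m) z" "k \<le> i" "i + 2 \<le> m"
    and cross: "z \<in> closed_segment (u (i + 1)) (u (i + 2))"
  shows "\<exists>n\<ge>1. horseshoe a b (f ^^ n)"
proof -
  define J where "J j = closed_segment (u j) z" for j
  have u_pow: "(f ^^ n) (u j) = u (j + n)" for n j by (induction n) (auto simp: u)
  have z_pow: "(f ^^ n) z = z" for n by (induction n) (auto simp: z)
  have J_step: "J (j + n) \<subseteq> (f ^^ n) ` J j" for j n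
    using segment_funpow_image[OF interval_map_axioms u(1) z(2), of n j] by (simp add: J_def u_pow z_pow)
  have J_return: "J k \<subseteq> J m" using return by (simp add: J_def subset_closed_segment)
  define n where "n = m - k"
  have n: "n \<ge> 2" using return by (simp add: n_def)
  \<comment> \<open>The chain runs from \<open>J (i + r)\<close> to \<open>J m\<close>, re-enters at
    \<open>J k\<close> and ends at \<open>J i\<close>: \<open>m - (i + r)\<close> plus
    \<open>i - k\<close> steps.\<close>
  have to_J: "J i \<subseteq> (f ^^ (n - r)) ` J (i + r)" if "r \<le> 2" for r
  proof -
    have "J i \<subseteq> (f ^^ (i - k)) ` J k" using J_step[of k "i - k"] return by simp
    also have "\<dots> \<subseteq> (f ^^ (i - k)) ` (f ^^ (m - (i + r))) ` J (i + r)"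
      using J_return J_step[of "i + r" "m - (i + r)"] that return by (intro image_mono) auto
    also have "\<dots> = (f ^^ (n - r)) ` J (i + r)"
      using that return by (simp add: image_comp funpow_add[symmetric] n_def)
    finally show ?thesis .
  qed
  have "z \<in> closed_segment (f (u i)) (f (u (Suc i)))" using cross u by simp
  then obtain c where c: "c \<in> closed_segment (u i) (u (Suc i))" "f c = z"
    using segment_image[OF u(1) u(1), of i "Suc i"] by (metis imageE subsetD)
  have c_in: "c \<in> {a..b}" using c segment_in[OF u(1) u(1)] by blast
  have "c \<noteq> u i" using c u(2)[of i] u(3)[of "Suc i"] by auto
  moreover have "c \<noteq> z" using c u(3)[of "Suc i"] u(3)[of i] toward
    by (auto simp: closed_segment_eq_real_ivl split: if_splits)
  moreover have c_J: "c \<in> J i" and c_u: "u (Suc i) \<in> closed_segment c z"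
    using c toward by (auto simp: J_def closed_segment_eq_real_ivl split: if_splits)
  ultimately have c_open: "c \<in> open_segment (u i) z" by (auto simp: J_def open_segment_def)
  define A where "A = closed_segment (u i) c"
  define B where "B = closed_segment c z"
  have AJ: "A \<subseteq> J i" "B \<subseteq> J i" using c_J by (auto simp: A_def B_def J_def subset_closed_segment)
  have "J (i + 1) \<subseteq> f ` A"
    using segment_image[OF u(1) c_in, of i] by (simp add: A_def J_def c u)
  then have "J i \<subseteq> (f ^^ (n - 1)) ` f ` A" using to_J[of 1] by (meson image_mono one_le_numeral order_trans)
  also have "\<dots> = (f ^^ n) ` A"
    using n by (simp add: image_comp funpow_Suc_right[symmetric] del: funpow.simps)
  finally have A: "J i \<subseteq> (f ^^ n) ` A" .
  \<comment> \<open>\<open>B\<close> contains \<open>u (i + 1)\<close>, which is one step ahead of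
    \<open>u i\<close> in the chain; this is where the step is gained.\<close>
  have "J (i + 2) \<subseteq> f ` closed_segment c (u (Suc i))"
    using segment_image[OF c_in u(1), of "Suc i"] by (simp add: J_def c u closed_segment_commute)
  also have "\<dots> \<subseteq> f ` B" using c_u by (intro image_mono) (auto simp: B_def subset_closed_segment)
  finally have "J i \<subseteq> (f ^^ (n - 2)) ` f ` B" using to_J[of 2] by (meson image_mono order_refl order_trans)
  also have "\<dots> = (f ^^ (n - 1)) ` B"
    using n by (simp add: image_comp funpow_Suc_right[symmetric] Suc_diff_Suc numeral_2_eq_2 del: funpow.simps)
  finally have B: "J i \<subseteq> (f ^^ (n - 1)) ` B" .
  have iterate: "J i \<subseteq> (f ^^ (r * Suc l)) ` S" if "J i \<subseteq> (f ^^ r) ` S" "S \<subseteq> J i" for r l S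
  proof (induction l)
    case (Suc l)
    have "J i \<subseteq> (f ^^ r) ` (f ^^ (r * Suc l)) ` S"
      using that Suc by (meson image_mono order_trans)
    then show ?case by (simp add: image_comp funpow_add[symmetric])
  qed (use that in simp)
  \<comment> \<open>These are \<open>n - 1\<close> rounds of length \<open>n\<close> in
    \<open>A\<close> and \<open>n\<close> rounds of length \<open>n - 1\<close> in \<open>B\<close>;
    \<open>iterate\<close> counts rounds by \<open>Suc l\<close>.\<close>
  have "J i \<subseteq> (f ^^ (n * (n - 1))) ` A" "J i \<subseteq> (f ^^ (n * (n - 1))) ` B"
    using iterate[OF A AJ(1), of "n - 2"] iterate[OF B AJ(2), of "n - 1"] n
    by (simp_all add: Suc_diff_Suc numeral_2_eq_2 mult.commute)
  then have "horseshoe a b (f ^^ (n * (n - 1)))"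
    unfolding horseshoe_def J_def A_def B_def using c_open u(1)[of i] z(2) by blast
  then show ?thesis using n by (intro exI[where x = "n * (n - 1)"]) auto
qed

end

section \<open>Horseshoes and entropy\<close>

text \<open>
  Disjointness is gained by shrinking the left half to a segment that avoids \<open>c\<close> and still covers
  one of the two halves; passing to \<open>g\<^sup>2\<close> makes up for the loss.
\<close>

lemma strict_horseshoe:
  assumes "interval_map a b g" "horseshoe a b g"
  shows "\<exists>J :: bool \<Rightarrow> real set. (\<forall>i. compact (J i) \<and> J i \<subseteq> {a..b} \<and> (\<Union>j. J j) \<subseteq> (g ^^ 2) ` J i) \<and>
    J True \<inter> J False = {} \<and> J True \<noteq> {}"
proof -
  interpret interval_map a b g by fact
  obtain p q c where pq: "p \<in> {a..b}" "q \<in> {a..b}" and c: "c \<in> open_segment p q"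
    and A: "closed_segment p q \<subseteq> g ` closed_segment p c"
    and B: "closed_segment p q \<subseteq> g ` closed_segment c q"
    using assms(2) unfolding horseshoe_def by blast
  have c_in: "c \<in> closed_segment p q" "c \<in> {a..b}" "c \<noteq> p" "c \<noteq> q"
    using c segment_in[OF pq] by (auto simp: open_segment_def)
  have sub: "closed_segment p c \<subseteq> {a..b}" using pq c_in segment_in by blast
  obtain \<alpha> where \<alpha>: "\<alpha> \<in> closed_segment p c" "g \<alpha> = p" using A by (metis ends_in_segment(1) imageE subsetD)
  obtain \<beta> where \<beta>: "\<beta> \<in> closed_segment p c" "g \<beta> = q" using A by (metis ends_in_segment(2) imageE subsetD)
  have avoid: "c \<notin> closed_segment s t \<and> closed_segment s t \<subseteq> closed_segment p c"
    if "s \<in> closed_segment p c" "t \<in> closed_segment p c" "s \<noteq> c" "t \<noteq> c" for s t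
    using that by (cases "p \<le> c"; cases "s \<le> t") (auto simp: closed_segment_eq_real_ivl)
  have preimage: "\<exists>t\<in>closed_segment p c. g t = c"
    using A c_in by (metis imageE subsetD)
  \<comment> \<open>Each of \<open>p\<close>, \<open>c\<close> and \<open>q\<close> has a preimage
    in the left half, and \<open>c\<close> can be only one of these. Any two of the three values
    span a segment that contains a half, so the two endpoints can avoid \<open>c\<close>.\<close>
  have "\<exists>s t. s \<in> closed_segment p c \<and> t \<in> closed_segment p c \<and> s \<noteq> c \<and> t \<noteq> c \<and>
    (closed_segment p c \<subseteq> closed_segment (g s) (g t) \<or> closed_segment c q \<subseteq> closed_segment (g s) (g t))"
  proof (cases "g c = c")
    case True
    then have "\<alpha> \<noteq> c" "\<beta> \<noteq> c" using \<alpha> \<beta> c_in by auto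
    then show ?thesis using \<alpha> \<beta> c_in
      by (intro exI[where x = \<alpha>] exI[where x = \<beta>]) (auto simp: subset_closed_segment)
  next
    case False
    obtain t where t: "t \<in> closed_segment p c" "g t = c" "t \<noteq> c" using preimage False by metis
    show ?thesis
    proof (cases "\<alpha> = c")
      case True
      then have "\<beta> \<noteq> c" using \<alpha> \<beta> c_in by auto
      then show ?thesis using t \<beta>
        by (intro exI[where x = t] exI[where x = \<beta>]) auto
    next
      case False
      then show ?thesis using t \<alpha>
        by (intro exI[where x = \<alpha>] exI[where x = t]) auto
    qed
  qed
  then obtain s t where st: "s \<in> closed_segment p c" "t \<in> closed_segment p c" "s \<noteq> c" "t \<noteq> c"
    "closed_segment p c \<subseteq> closed_segment (g s) (g t) \<or> closed_segment c q \<subseteq> closed_segment (g s) (g t)"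
    by blast
  have "closed_segment (g s) (g t) \<subseteq> g ` closed_segment s t"
    by (rule segment_image) (use st sub in auto)
  then have "closed_segment p c \<subseteq> g ` closed_segment s t \<or> closed_segment c q \<subseteq> g ` closed_segment s t"
    using st by blast
  then have "g ` closed_segment p c \<subseteq> g ` g ` closed_segment s t \<or>
      g ` closed_segment c q \<subseteq> g ` g ` closed_segment s t"
    by (meson image_mono)
  moreover have sq: "(g ^^ 2) ` S = g ` g ` S" for S by (simp add: numeral_2_eq_2 image_image)
  ultimately have left: "closed_segment p q \<subseteq> (g ^^ 2) ` closed_segment s t"
    using A B unfolding sq by (meson order_trans)
  have "closed_segment c q \<subseteq> closed_segment p q" using c_in by (simp add: subset_closed_segment)
  then have "closed_segment c q \<subseteq> g ` closed_segment c q" using B by blast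
  then have "g ` closed_segment c q \<subseteq> g ` g ` closed_segment c q" by (rule image_mono)
  then have right: "closed_segment p q \<subseteq> (g ^^ 2) ` closed_segment c q"
    using B unfolding sq by (rule order_trans[rotated])
  define J where "J i = (if i then closed_segment s t else closed_segment c q)" for i
  have st_avoid: "c \<notin> closed_segment s t" "closed_segment s t \<subseteq> closed_segment p c"
    using avoid[of s t] st by auto
  moreover have "closed_segment p c \<inter> closed_segment c q = {c}"
    using c by (auto simp: closed_segment_eq_real_ivl open_segment_eq_real_ivl split: if_splits)
  ultimately have "J True \<inter> J False = {}" unfolding J_def by auto
  moreover have "closed_segment s t \<subseteq> closed_segment p q"
    using st_avoid c_in by (meson ends_in_segment(1) subset_closed_segment order_trans)
  then have union: "(\<Union>j. J j) \<subseteq> closed_segment p q"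
    using \<open>closed_segment c q \<subseteq> closed_segment p q\<close> by (auto simp: J_def del: subsetI intro!: UN_least)
  moreover have "(\<Union>j. J j) \<subseteq> (g ^^ 2) ` J i" for i
    by (rule order_trans[OF union]) (use left right in \<open>simp add: J_def\<close>)
  moreover have "J i \<subseteq> {a..b}" for i
    using union segment_in[OF pq] by blast
  moreover have "compact (J i)" for i by (simp add: J_def)
  moreover have "J True \<noteq> {}" by (simp add: J_def)
  ultimately have "(\<forall>i. compact (J i) \<and> J i \<subseteq> {a..b} \<and> (\<Union>j. J j) \<subseteq> (g ^^ 2) ` J i) \<and>
    J True \<inter> J False = {} \<and> J True \<noteq> {}" by metis
  then show ?thesis by (rule exI[where x = J])
qed

text \<open>The point is built backwards: one that follows the shifted word lies in some
  \<open>J j\<close>, so it has a preimage in \<open>J (w 0)\<close>.\<close>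

lemma follow_itinerary:
  fixes J :: "bool \<Rightarrow> 'a set"
  assumes "\<And>i. (\<Union>j. J j) \<subseteq> h ` J i"  "J True \<noteq> {}"
  shows "\<exists>x\<in>J (w 0). \<forall>i\<le>n. (h ^^ i) x \<in> J (w i)"
proof (induction n arbitrary: w)
  case 0
  have "J i \<noteq> {}" for i using assms by (metis UN_upper image_is_empty subset_empty UNIV_I)
  then show ?case by auto
next
  case (Suc n)
  obtain y where y: "y \<in> J (w 1)" "\<forall>i\<le>n. (h ^^ i) y \<in> J (w (Suc i))"
    using Suc[of "\<lambda>i. w (Suc i)"] by auto
  then obtain x where x: "x \<in> J (w 0)" "h x = y" using assms(1)[of "w 0"] by blast
  have "(h ^^ i) x \<in> J (w i)" if "i \<le> Suc n" for i
    using that x y by (cases i) (auto simp: funpow_Suc_right simp del: funpow.simps)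
  then show ?case using x by blast
qed

text \<open>Distinct itineraries of length \<open>n + 1\<close> are told apart at some time
  \<open>r * i\<close>. So there are \<open>2 ^ (n + 1)\<close> separated points for
  \<open>r * (n + 1)\<close> steps, which gives the lower bound \<open>ln 2 / r\<close>.\<close>

lemma entropy_positive:
  fixes J :: "bool \<Rightarrow> 'a::heine_borel set"
  assumes J: "\<And>i. compact (J i)" "\<And>i. J i \<subseteq> X" "\<And>i. (\<Union>j. J j) \<subseteq> (f ^^ r) ` J i"
    and disj: "J True \<inter> J False = {}" and ne: "J True \<noteq> {}" and r: "r \<ge> 1"
  shows "topological_entropy X f > 0"
proof -
  obtain d where d: "d > 0" "\<forall>x\<in>J True. \<forall>y\<in>J False. d \<le> dist x y"
    using separate_compact_closed[OF J(1) compact_imp_closed[OF J(1)] disj] by blast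
  \<comment> \<open>Half of \<open>d\<close> is used because separated sets ask for a strict
    inequality.\<close>
  have gap: "dist x y > d / 2" if "x \<in> J i" "y \<in> J j" "i \<noteq> j" for x y i j
  proof -
    have "d \<le> dist x y" using that d(2) by (cases i; cases j) (auto simp: dist_commute)
    then show ?thesis using d(1) by simp
  qed
  define u where "u n = (SUP E\<in>separated_sets X f n (d / 2). ereal (ln (real (card E)) / real n))" for n
  have "ereal (ln 2 / r) \<le> u (r * Suc n)" for n
  proof -
    \<comment> \<open>A word is encoded by the set \<open>S\<close> of positions at which it
      prescribes \<open>J True\<close>.\<close>
    have "\<exists>y. y \<in> J (0 \<in> S) \<and> (\<forall>i\<le>n. ((f ^^ r) ^^ i) y \<in> J (i \<in> S))" for S
      using follow_itinerary[of J "f ^^ r" "\<lambda>i. i \<in> S" n, OF J(3) ne] by blast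
    then have "\<forall>S. \<exists>y. y \<in> J (0 \<in> S) \<and> (\<forall>i\<le>n. (f ^^ (r * i)) y \<in> J (i \<in> S))"
      by (simp add: funpow_mult)
    from choice[OF this] obtain x where x_all: "\<forall>S. x S \<in> J (0 \<in> S) \<and> (\<forall>i\<le>n. (f ^^ (r * i)) (x S) \<in> J (i \<in> S))" ..
    have x: "x S \<in> J (0 \<in> S)" "i \<le> n \<Longrightarrow> (f ^^ (r * i)) (x S) \<in> J (i \<in> S)" for S i
      by (rule x_all[rule_format, THEN conjunct1], rule x_all[rule_format, THEN conjunct2, rule_format])
    have sep: "\<exists>k<r * Suc n. dist ((f ^^ k) (x S)) ((f ^^ k) (x T)) > d / 2"
      if "S \<subseteq> {..n}" "T \<subseteq> {..n}" "S \<noteq> T" for S T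
    proof -
      obtain i where i: "(i \<in> S) \<noteq> (i \<in> T)" using \<open>S \<noteq> T\<close> by (auto simp: set_eq_iff)
      then have i_le: "i \<le> n" using that by auto
      have "r * i < r * Suc n" using i_le r by (intro mult_less_mono2) auto
      then show ?thesis using gap[OF x(2)[OF i_le] x(2)[OF i_le] i] by blast
    qed
    have inj: "inj_on x (Pow {..n})"
    proof (rule inj_onI)
      fix S T assume *: "S \<in> Pow {..n}" "T \<in> Pow {..n}" "x S = x T"
      then show "S = T" using sep[of S T] d(1) by (cases "S = T") auto
    qed
    define E where "E = x ` Pow {..n}"
    have "card E = 2 ^ Suc n" using inj by (simp add: E_def card_image card_Pow del: power_Suc)
    then have "ln (real (card E)) = Suc n * ln 2"
      by (metis ln_realpow of_nat_numeral of_nat_power zero_less_numeral)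
    then have "ln 2 / r = ln (real (card E)) / real (r * Suc n)"
      by (simp only: of_nat_mult) (metis mult.commute mult_divide_mult_cancel_left of_nat_Suc of_nat_neq_0)
    moreover have "E \<in> separated_sets X f (r * Suc n) (d / 2)"
    proof -
      have "x S \<in> X" for S using x(1) J(2) by blast
      moreover have "finite E" by (simp add: E_def)
      moreover have "\<exists>k<r * Suc n. dist ((f ^^ k) y) ((f ^^ k) z) > d / 2" if yz: "y \<in> E" "z \<in> E" "y \<noteq> z" for y z
      proof -
        obtain S T where "y = x S" "z = x T" "S \<subseteq> {..n}" "T \<subseteq> {..n}"
          using yz(1,2) unfolding E_def by blast
        then show ?thesis using sep[of S T] yz(3) by metis
      qed
      ultimately show ?thesis unfolding separated_sets_def E_def by auto
    qed
    ultimately show ?thesis unfolding u_def by (intro SUP_upper2[of E]) simp_all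
  qed
  then have "ereal (ln 2 / r) \<le> limsup (u \<circ> (\<lambda>n. r * Suc n))"
    by (intro le_Limsup) (auto simp del: mult_Suc_right)
  also have "\<dots> \<le> limsup u"
    by (rule limsup_subseq_mono) (use r in \<open>auto simp: strict_mono_def\<close>)
  also have "\<dots> \<le> topological_entropy X f"
    unfolding topological_entropy_def u_def by (rule SUP_upper) (use d in auto)
  finally have "ereal (ln 2 / r) \<le> topological_entropy X f" .
  moreover have "0 < ereal (ln 2 / r)" using r by simp
  ultimately show ?thesis by (metis less_le_trans)
qed

lemma horseshoe_free_if_zero_entropy:
  assumes f: "interval_map a b f" and entropy: "topological_entropy {a..b} f = 0"
  shows "horseshoe_free a b f"
proof (rule ccontr)
  assume "\<not> horseshoe_free a b f"
  then obtain k where k: "k \<ge> 1" "horseshoe a b (f ^^ k)" by (auto simp: horseshoe_free_def)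
  obtain J :: "bool \<Rightarrow> real set" where J: "\<And>i. compact (J i)" "\<And>i. J i \<subseteq> {a..b}"
    "\<And>i. (\<Union>j. J j) \<subseteq> ((f ^^ k) ^^ 2) ` J i" "J True \<inter> J False = {}" "J True \<noteq> {}"
    using strict_horseshoe[OF interval_map.interval_map_funpow[OF f] k(2)] by metis
  have "topological_entropy {a..b} f > 0"
  proof (rule entropy_positive[where r = "k * 2"])
    show "(\<Union>j. J j) \<subseteq> (f ^^ (k * 2)) ` J i" for i using J(3) by (simp add: funpow_mult mult.commute)
  qed (use J k in auto)
  then show False using entropy by simp
qed

section \<open>Cluster points of orbits\<close>

definition cluster_points :: "(nat \<Rightarrow> 'a::metric_space) \<Rightarrow> 'a set" where
  "cluster_points u = {y. \<forall>e>0. \<forall>N. \<exists>n\<ge>N. dist (u n) y < e}"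

lemma cluster_pointsD: "y \<in> cluster_points u \<Longrightarrow> e > 0 \<Longrightarrow> \<exists>n\<ge>N. dist (u n) y < e"
  unfolding cluster_points_def by blast

lemma cluster_pointsI: "(\<And>e N. e > 0 \<Longrightarrow> \<exists>n\<ge>N. dist (u n) y < e) \<Longrightarrow> y \<in> cluster_points u"
  unfolding cluster_points_def by blast

lemma cluster_points_subseq:
  assumes "\<And>n. r n \<ge> n" shows "cluster_points (\<lambda>n. u (r n)) \<subseteq> cluster_points u"
proof
  fix y assume y: "y \<in> cluster_points (\<lambda>n. u (r n))"
  show "y \<in> cluster_points u"
  proof (rule cluster_pointsI)
    fix e :: real and N assume "e > 0"
    then obtain n where "n \<ge> N" "dist (u (r n)) y < e" using cluster_pointsD[OF y] by blast
    then show "\<exists>n\<ge>N. dist (u n) y < e" using assms order_trans by blast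
  qed
qed

lemma cluster_points_shift: "cluster_points (\<lambda>n. u (n + k)) = cluster_points u"
proof
  show "cluster_points (\<lambda>n. u (n + k)) \<subseteq> cluster_points u" by (rule cluster_points_subseq) simp
  show "cluster_points u \<subseteq> cluster_points (\<lambda>n. u (n + k))"
  proof
    fix y assume y: "y \<in> cluster_points u"
    show "y \<in> cluster_points (\<lambda>n. u (n + k))"
    proof (rule cluster_pointsI)
      fix e :: real and N assume "e > 0"
      then obtain n where n: "n \<ge> N + k" "dist (u n) y < e" using cluster_pointsD[OF y] by blast
      then show "\<exists>n\<ge>N. dist (u (n + k)) y < e" by (intro exI[where x = "n - k"]) auto
    qed
  qed
qed

lemma cluster_points_even_odd:
  "cluster_points u = cluster_points (\<lambda>n. u (2 * n)) \<union> cluster_points (\<lambda>n. u (2 * n + 1))"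
proof (intro antisym subsetI)
  fix y assume y: "y \<in> cluster_points u"
  show "y \<in> cluster_points (\<lambda>n. u (2 * n)) \<union> cluster_points (\<lambda>n. u (2 * n + 1))"
  proof (rule ccontr)
    assume "y \<notin> cluster_points (\<lambda>n. u (2 * n)) \<union> cluster_points (\<lambda>n. u (2 * n + 1))"
    then obtain d e M N where d: "d > 0" "\<And>n. n \<ge> M \<Longrightarrow> \<not> dist (u (2 * n)) y < d"
      and e: "e > 0" "\<And>n. n \<ge> N \<Longrightarrow> \<not> dist (u (2 * n + 1)) y < e"
      unfolding cluster_points_def by blast
    obtain n where n: "n \<ge> 2 * M + 2 * N" "dist (u n) y < min d e"
      using cluster_pointsD[OF y, of "min d e" "2 * M + 2 * N"] d e by auto
    have "n = 2 * (n div 2) \<or> n = 2 * (n div 2) + 1" "n div 2 \<ge> M" "n div 2 \<ge> N" using n by auto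
    then show False using d(2)[of "n div 2"] e(2)[of "n div 2"] n(2) by auto
  qed
qed (auto dest: subsetD[OF cluster_points_subseq, rotated])

lemma closed_cluster_points: "closed (cluster_points u)"
  unfolding closed_def open_dist
proof (intro ballI)
  fix y assume "y \<in> - cluster_points u"
  then obtain e N where e: "e > 0" "\<And>n. n \<ge> N \<Longrightarrow> \<not> dist (u n) y < e" unfolding cluster_points_def by blast
  have "x \<in> - cluster_points u" if x: "dist x y < e / 2" for x
  proof
    assume "x \<in> cluster_points u"
    then obtain n where n: "n \<ge> N" "dist (u n) x < e / 2" using cluster_pointsD[of x u "e / 2" N] e by auto
    then have "dist (u n) y < e" using x by metric
    then show False using e n by blast
  qed
  then show "\<exists>e>0. \<forall>x. dist x y < e \<longrightarrow> x \<in> - cluster_points u" using e by (intro exI[where x = "e / 2"]) auto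
qed

text \<open>Only infinitely many terms are required to lie in \<open>C\<close>, so that the lemma
  also applies to the terms that stay away from a given set.\<close>

lemma cluster_point_exists:
  assumes C: "compact C" and inf: "\<And>N. \<exists>n\<ge>N. u n \<in> C"
  shows "\<exists>y\<in>C. y \<in> cluster_points u"
proof -
  have "infinite {n. u n \<in> C}" unfolding infinite_nat_iff_unbounded_le using inf by auto
  then obtain r :: "nat \<Rightarrow> nat" where r: "strict_mono r" "\<forall>n. u (r n) \<in> C" using infinite_enumerate by force
  then obtain y s where y: "y \<in> C" "strict_mono s" "((\<lambda>n. u (r n)) \<circ> s) \<longlonglongrightarrow> y"
    using C unfolding compact_eq_seq_compact_metric seq_compact_def by metis
  have "y \<in> cluster_points u"
  proof (rule cluster_pointsI)
    fix e :: real and N assume "e > 0"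
    then obtain M where M: "\<And>n. n \<ge> M \<Longrightarrow> dist (u (r (s n))) y < e"
      using y(3) unfolding lim_sequentially by auto
    have "r (s (max M N)) \<ge> N"
      using seq_suble[OF r(1)] seq_suble[OF y(2)] by (meson max.cobounded2 order_trans)
    then show "\<exists>n\<ge>N. dist (u n) y < e" using M[of "max M N"] by auto
  qed
  then show ?thesis using y by blast
qed

lemma cluster_points_subset: "closed C \<Longrightarrow> (\<And>n. u n \<in> C) \<Longrightarrow> cluster_points u \<subseteq> C"
proof
  fix y assume C: "closed C" "\<And>n. u n \<in> C" "y \<in> cluster_points u"
  have "y \<in> closure C" unfolding closure_approachable using C cluster_pointsD by blast
  then show "y \<in> C" using C by simp
qed

lemma eventually_near_cluster_points:
  assumes C: "compact C" "\<And>n. u n \<in> C" and e: "e > 0"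
  shows "\<exists>N. \<forall>n\<ge>N. \<exists>y\<in>cluster_points u. dist (u n) y < e"
proof (rule ccontr)
  assume "\<not> ?thesis"
  then have "\<exists>n\<ge>N. u n \<in> C - (\<Union>y\<in>cluster_points u. ball y e)" for N
    using C by (auto simp: dist_commute)
  then obtain y where "y \<in> C - (\<Union>y\<in>cluster_points u. ball y e)" "y \<in> cluster_points u"
    using cluster_point_exists[OF compact_diff[OF C(1)], of "\<Union>y\<in>cluster_points u. ball y e" u]
    by blast
  then show False using e by auto
qed

text \<open>Continuity gives one inclusion. The other needs compactness: the image of the cluster
  set is closed, and the terms of \<open>u\<close> are eventually close to the cluster set, so no
  value off the image is approached.\<close>

lemma cluster_points_image:
  assumes C: "compact C" "\<And>n. u n \<in> C" and f: "continuous_on C f"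
  shows "cluster_points (\<lambda>n. f (u n)) = f ` cluster_points u"
proof
  have sub: "cluster_points u \<subseteq> C" using cluster_points_subset compact_imp_closed C by blast
  show "f ` cluster_points u \<subseteq> cluster_points (\<lambda>n. f (u n))"
  proof
    fix z assume "z \<in> f ` cluster_points u"
    then obtain y where y: "y \<in> cluster_points u" "z = f y" by blast
    show "z \<in> cluster_points (\<lambda>n. f (u n))"
    proof (rule cluster_pointsI)
      fix e :: real and N assume "e > 0"
      then obtain d where d: "d > 0" "\<And>x. x \<in> C \<Longrightarrow> dist x y < d \<Longrightarrow> dist (f x) (f y) < e"
        using f y sub unfolding continuous_on_iff by blast
      then show "\<exists>n\<ge>N. dist (f (u n)) z < e" using cluster_pointsD[OF y(1) d(1)] C y by blast
    qed
  qed
  show "cluster_points (\<lambda>n. f (u n)) \<subseteq> f ` cluster_points u"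
  proof (rule ccontr)
    assume "\<not> ?thesis"
    then obtain z where z: "z \<in> cluster_points (\<lambda>n. f (u n))" "z \<notin> f ` cluster_points u" by blast
    have "compact (cluster_points u)"
      using sub C closed_cluster_points compact_Int_closed by (metis inf.absorb2)
    then have "closed (f ` cluster_points u)"
      using continuous_on_subset[OF f sub] compact_continuous_image compact_imp_closed by blast
    then obtain e where e: "e > 0" "\<And>x. x \<in> f ` cluster_points u \<Longrightarrow> \<not> dist x z < e"
      using z unfolding closed_def open_dist by auto blast
    obtain d where d: "d > 0" "\<And>x y. x \<in> C \<Longrightarrow> y \<in> C \<Longrightarrow> dist x y < d \<Longrightarrow> dist (f x) (f y) < e / 2"
      using compact_uniformly_continuous[OF f C(1)] e unfolding uniformly_continuous_on_def
      by (metis half_gt_zero)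
    obtain N where N: "\<forall>n\<ge>N. \<exists>y\<in>cluster_points u. dist (u n) y < d"
      using eventually_near_cluster_points[where u = u, OF C d(1)] by blast
    obtain n where n: "n \<ge> N" "dist (f (u n)) z < e / 2" using cluster_pointsD[OF z(1)] e by (metis half_gt_zero)
    then obtain y where y: "y \<in> cluster_points u" "dist (u n) y < d" using N by blast
    then have "dist (f (u n)) (f y) < e / 2" using d(2) C sub by blast
    then have "dist (f y) z < e" using n by metric
    then show False using e y by blast
  qed
qed

lemma cluster_points_convergent:
  assumes "u \<longlonglongrightarrow> l" shows "cluster_points u \<subseteq> {l}"
proof
  fix y assume y: "y \<in> cluster_points u"
  show "y \<in> {l}"
  proof (rule ccontr)
    assume "y \<notin> {l}"
    then have pos: "dist y l / 2 > 0" by simp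
    then obtain N where N: "\<And>n. n \<ge> N \<Longrightarrow> dist (u n) l < dist y l / 2"
      using assms unfolding lim_sequentially by blast
    obtain n where "n \<ge> N" "dist (u n) y < dist y l / 2" using cluster_pointsD[OF y pos] by blast
    then show False using N[of n] by metric
  qed
qed

lemma infinite_real_three:
  fixes S :: "real set"
  assumes "infinite S"
  shows "\<exists>x\<in>S. \<exists>y\<in>S. \<exists>z\<in>S. x < y \<and> y < z"
proof -
  obtain x where x: "x \<in> S" using assms by fastforce
  have "infinite (S - {x})" using assms by simp
  then obtain y where y: "y \<in> S" "y \<noteq> x" by (metis Diff_iff finite.emptyI insertCI equals0I)
  have "infinite (S - {x} - {y})" using \<open>infinite (S - {x})\<close> by simp
  then obtain z where z: "z \<in> S" "z \<noteq> x" "z \<noteq> y" by (metis Diff_iff finite.emptyI insertCI equals0I)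
  show ?thesis using x y z by (metis linorder_neqE)
qed

section \<open>Alternation around a fixed point\<close>

context interval_map
begin

text \<open>An up point above a down point is the configuration of
  \<open>horseshoe_if_down_then_up\<close> if it is the later of the two in time, and the mirror
  image of that configuration if it is the earlier one.\<close>

lemma up_below_down:
  assumes free: "horseshoe_free a b f" and x: "x \<in> {a..b}"
    and up: "(f ^^ k) x < (f ^^ Suc k) x" and down: "(f ^^ Suc l) x < (f ^^ l) x"
  shows "(f ^^ k) x < (f ^^ l) x"
proof (rule ccontr)
  assume "\<not> (f ^^ k) x < (f ^^ l) x"
  moreover have "(f ^^ k) x \<noteq> (f ^^ l) x" using up down by auto
  ultimately have less: "(f ^^ l) x < (f ^^ k) x" by simp
  have no: "\<not> (\<exists>n\<ge>1. horseshoe a b (f ^^ n))" using free by (auto simp: horseshoe_free_def)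
  show False
  proof (cases "l \<le> k")
    case True
    then have "(f ^^ (k - l)) ((f ^^ l) x) = (f ^^ k) x"
      by (simp add: funpow_add[symmetric, THEN fun_cong, unfolded comp_def])
    then show False
      using horseshoe_if_down_then_up[of "(f ^^ l) x" "k - l"] no up down less funpow_in[OF x] by auto
  next
    case False
    \<comment> \<open>The mirrored map exchanges up points and down points.\<close>
    interpret mirror: interval_map "- b" "- a" "\<lambda>x. - f (- x)"
      by (rule interval_map_mirror) (rule interval_map_axioms)
    have "(f ^^ (l - k)) ((f ^^ k) x) = (f ^^ l) x"
      using False by (simp add: funpow_add[symmetric, THEN fun_cong, unfolded comp_def])
    moreover have "- (f ^^ k) x \<in> {- b..- a}" using funpow_in[OF x, of k] by auto
    ultimately have "\<exists>n\<ge>1. horseshoe (- b) (- a) ((\<lambda>x. - f (- x)) ^^ n)"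
      using mirror.horseshoe_if_down_then_up[of "- (f ^^ k) x" "l - k"] up down less
      by (auto simp: funpow_mirror)
    then show False using horseshoe_free_mirror[OF free] by (auto simp: horseshoe_free_def)
  qed
qed

end

text \<open>The inequalities are not strict because limits of points strictly on one side of
  \<open>z\<close> may equal \<open>z\<close>. Both orders are allowed, since it is not known which
  parity of times lies on which side.\<close>

definition weakly_separated :: "real \<Rightarrow> real set \<Rightarrow> real set \<Rightarrow> bool" where
  "weakly_separated z S T \<longleftrightarrow> (\<forall>s\<in>S. s \<le> z) \<and> (\<forall>t\<in>T. z \<le> t) \<or> (\<forall>s\<in>S. z \<le> s) \<and> (\<forall>t\<in>T. t \<le> z)"

context interval_map
begin

text \<open>Such a sequence converges. Hence an orbit with an infinite limit set goes up infinitely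
  often and down infinitely often.\<close>

lemma cluster_points_eventually_monotone:
  fixes u :: "nat \<Rightarrow> real"
  assumes u: "\<And>n. u n \<in> {a..b}"
    and mono: "(\<forall>n\<ge>N. u (Suc n) \<le> u n) \<or> (\<forall>n\<ge>N. u n \<le> u (Suc n))"
  shows "finite (cluster_points u)"
proof -
  have "monoseq (\<lambda>n. u (n + N))" using mono unfolding monoseq_Suc by auto
  moreover have "Bseq (\<lambda>n. u (n + N))"
  proof (rule BseqI')
    show "norm (u (n + N)) \<le> max \<bar>a\<bar> \<bar>b\<bar>" for n using u[of "n + N"] by auto
  qed
  ultimately obtain l where "(\<lambda>n. u (n + N)) \<longlonglongrightarrow> l" using Bseq_monoseq_convergent convergent_def by blast
  then have "cluster_points u \<subseteq> {l}" using cluster_points_convergent cluster_points_shift by metis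
  then show ?thesis by (rule finite_subset) simp
qed

lemma eventually_alternating:
  fixes x :: real
  defines "u \<equiv> \<lambda>n. (f ^^ n) x"
  assumes free: "horseshoe_free a b f" and x: "x \<in> {a..b}" and inf: "infinite (cluster_points u)"
  shows "\<exists>z\<in>{a..b}. f z = z \<and> (\<exists>K. \<forall>k\<ge>K. u k \<noteq> z \<and> (u k < z \<longleftrightarrow> z < u (Suc k)))"
proof -
  have u_in: "u n \<in> {a..b}" and u_Suc: "u (Suc n) = f (u n)" for n
    using funpow_in[OF x] by (auto simp: u_def)
  have not_fixed: "f (u k) \<noteq> u k" for k
  proof
    assume "f (u k) = u k"
    then have "u (j + k) = u k" for j by (induction j) (auto simp: u_Suc)
    then have "u (Suc n) \<le> u n" if "n \<ge> k" for n using that by (metis add.commute le_Suc_ex le_SucI order_refl)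
    then show False using inf cluster_points_eventually_monotone[of u k] u_in by blast
  qed
  have ups: "\<exists>n\<ge>N. u n < u (Suc n)" for N
    using inf cluster_points_eventually_monotone[of u N] u_in by (meson not_le)
  have downs: "\<exists>n\<ge>N. u (Suc n) < u n" for N
    using inf cluster_points_eventually_monotone[of u N] u_in by (meson not_le)
  define U where "U = {u k |k. u k < u (Suc k)}"
  define D where "D = {u k |k. u (Suc k) < u k}"
  have UD: "s \<le> t" if "s \<in> U" "t \<in> D" for s t
    using that up_below_down[OF free x] unfolding U_def D_def u_def by fastforce
  have ne: "U \<noteq> {}" "D \<noteq> {}" using ups downs unfolding U_def D_def by auto
  have bdd: "bdd_above U" "bdd_below D"
    using u_in unfolding U_def D_def bdd_above_def bdd_below_def by fastforce+
  \<comment> \<open>The inequality \<open>y \<le> f y\<close> survives in the limit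
    \<open>Sup U\<close>, and its reverse in \<open>Inf D\<close>, so a fixed point lies between the
    two.\<close>
  have "closed {y \<in> {a..b}. y \<le> f y}" "closed {y \<in> {a..b}. f y \<le> y}"
    by (intro continuous_on_closed_Collect_le cont continuous_intros; simp)+
  moreover have "U \<subseteq> {y \<in> {a..b}. y \<le> f y}" "D \<subseteq> {y \<in> {a..b}. f y \<le> y}"
    using u_in u_Suc unfolding U_def D_def by fastforce+
  ultimately have "Sup U \<in> {y \<in> {a..b}. y \<le> f y}" "Inf D \<in> {y \<in> {a..b}. f y \<le> y}"
    using closure_contains_Sup[OF ne(1) bdd(1)] closure_contains_Inf[OF ne(2) bdd(2)] closure_minimal
    by (blast+)
  then have "\<exists>r\<in>closed_segment (Sup U) (Inf D). f r = r"
    by (intro fixed_point_between) auto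
  moreover have "Sup U \<le> Inf D" using ne UD by (meson cSup_least cInf_greatest)
  ultimately obtain z where z: "Sup U \<le> z" "z \<le> Inf D" "f z = z"
    by (auto simp: closed_segment_eq_real_ivl)
  have z_in: "z \<in> {a..b}" using z \<open>Sup U \<in> _\<close> \<open>Inf D \<in> _\<close> by auto
  have u_z: "u k \<noteq> z" for k using not_fixed z by metis
  have up_iff: "u k < u (Suc k) \<longleftrightarrow> u k < z" for k
  proof
    assume "u k < u (Suc k)"
    then have "u k \<le> Sup U" using bdd by (intro cSup_upper) (auto simp: U_def)
    then show "u k < z" using z u_z[of k] by auto
  next
    assume "u k < z"
    show "u k < u (Suc k)"
    proof (rule ccontr)
      assume "\<not> u k < u (Suc k)"
      then have "u k \<in> D" using not_fixed[of k] u_Suc[of k] by (auto simp: D_def)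
      then have "Inf D \<le> u k" using bdd by (intro cInf_lower)
      then show False using z \<open>u k < z\<close> by simp
    qed
  qed
  have "\<exists>K. \<forall>k\<ge>K. u k < z \<longleftrightarrow> z < u (Suc k)"
  proof (rule ccontr)
    assume "\<not> ?thesis"
    then have repeat: "\<exists>k\<ge>K. (u k < z) = (u (Suc k) < z)" for K using u_z by (metis linorder_neqE not_less_iff_gr_or_eq)
    \<comment> \<open>So orbit points left of \<open>z\<close> lie below the limit set and those right of \<open>z\<close> above it,
      and a cluster point cannot lie strictly between two others.\<close>
    have escape: "\<exists>K. \<forall>m\<ge>K. u k \<notin> closed_segment (u m) z" for k
    proof -
      \<comment> \<open>From a non-alternating time \<open>i0\<close> after \<open>k\<close>, the
        next change of side \<open>j\<close> gives \<open>i = j - 2\<close>: \<open>u i\<close> and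
        \<open>u (i + 1)\<close> are on one side of \<open>z\<close>, and \<open>u (i + 2)\<close>
        is on the other.\<close>
      obtain i0 where i0: "i0 \<ge> k" "(u i0 < z) = (u (Suc i0) < z)" using repeat by blast
      have "\<exists>j>i0. (u j < z) \<noteq> (u i0 < z)"
        using ups[of "Suc i0"] downs[of "Suc i0"] up_iff by (metis Suc_le_lessD order_less_asym)
      define j where "j = (LEAST j. j > i0 \<and> (u j < z) \<noteq> (u i0 < z))"
      have j: "j > i0" "(u j < z) \<noteq> (u i0 < z)"
        using LeastI_ex[OF \<open>\<exists>j>i0. (u j < z) \<noteq> (u i0 < z)\<close>] by (auto simp: j_def)
      have same: "(u l < z) = (u i0 < z)" if "i0 \<le> l" "l < j" for l
        using not_less_Least[of l "\<lambda>j. j > i0 \<and> (u j < z) \<noteq> (u i0 < z)"] that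
        by (cases "l = i0") (auto simp: j_def)
      have "j \<noteq> Suc i0" using j i0 by auto
      then have j2: "j \<ge> i0 + 2" using j by simp
      define i where "i = j - 2"
      have i: "i \<ge> i0" "i + 2 = j" "Suc i < j" using j2 by (auto simp: i_def)
      have sides: "(u (Suc i) < z) = (u i < z)" "(u (i + 2) < z) \<noteq> (u i < z)"
        using same[of i] same[of "Suc i"] i j by auto
      \<comment> \<open>By \<open>up_iff\<close> the orbit always moves in the direction of
        \<open>z\<close>, and in this step it does not cross.\<close>
      have toward: "u (Suc i) \<in> closed_segment (u i) z"
        using up_iff[of i] sides u_z[of i] u_z[of "Suc i"]
        by (auto simp: closed_segment_eq_real_ivl)
      have cross: "z \<in> closed_segment (u (i + 1)) (u (i + 2))"
        using sides u_z[of "i + 2"] u_z[of "Suc i"] by (auto simp: closed_segment_eq_real_ivl)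
      have "u k \<notin> closed_segment (u m) z" if "m \<ge> j" for m
      proof
        assume "u k \<in> closed_segment (u m) z"
        then have "\<exists>n\<ge>1. horseshoe a b (f ^^ n)"
          using horseshoe_if_nonalternating_return[of u z i k m] u_in u_Suc u_z z z_in toward cross i i0 that
          by auto
        then show False using free by (auto simp: horseshoe_free_def)
      qed
      then show ?thesis by blast
    qed
    obtain y1 y2 y3 where y: "y1 \<in> cluster_points u" "y2 \<in> cluster_points u" "y3 \<in> cluster_points u"
      "y1 < y2" "y2 < y3" using infinite_real_three[OF inf] by blast
    define e where "e = min (y2 - y1) (y3 - y2) / 2"
    have e: "e > 0" "2 * e \<le> y2 - y1" "2 * e \<le> y3 - y2" using y by (auto simp: e_def)
    obtain k where k: "dist (u k) y2 < e" using cluster_pointsD[OF y(2) e(1)] by blast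
    obtain K where K: "\<And>m. m \<ge> K \<Longrightarrow> u k \<notin> closed_segment (u m) z" using escape by blast
    obtain m1 where m1: "m1 \<ge> K" "dist (u m1) y1 < e" using cluster_pointsD[OF y(1) e(1)] by blast
    obtain m3 where m3: "m3 \<ge> K" "dist (u m3) y3 < e" using cluster_pointsD[OF y(3) e(1)] by blast
    show False
    proof (cases "u k < z")
      case True
      then have "u k \<in> closed_segment (u m1) z"
        using k m1 e by (auto simp: closed_segment_eq_real_ivl dist_real_def)
      then show False using K m1 by blast
    next
      case False
      then have "u k \<in> closed_segment (u m3) z"
        using k m3 e by (auto simp: closed_segment_eq_real_ivl dist_real_def)
      then show False using K m3 by blast
    qed
  qed
  then show ?thesis using z z_in u_z by blast
qed

text \<open>From time \<open>K\<close> on, the side of \<open>z\<close> depends only on the parity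
  of the time; dropping the earlier terms leaves the cluster points unchanged.\<close>

lemma even_odd_weakly_separated:
  fixes x :: real
  defines "u \<equiv> \<lambda>n. (f ^^ n) x"
  assumes free: "horseshoe_free a b f" and x: "x \<in> {a..b}" and inf: "infinite (cluster_points u)"
  shows "\<exists>z\<in>{a..b}. f z = z \<and>
    weakly_separated z (cluster_points (\<lambda>n. u (2 * n))) (cluster_points (\<lambda>n. u (2 * n + 1)))"
proof -
  obtain z K where z: "z \<in> {a..b}" "f z = z" and K: "\<And>k. k \<ge> K \<Longrightarrow> u k \<noteq> z" "\<And>k. k \<ge> K \<Longrightarrow> u k < z \<longleftrightarrow> z < u (Suc k)"
    using eventually_alternating[OF free x] inf unfolding u_def by blast
  have side: "(u (2 * (n + K)) < z) = (u (2 * K) < z) \<and> (z < u (2 * (n + K) + 1)) = (u (2 * K) < z)" for n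
  proof (induction n)
    case 0
    then show ?case using K(2)[of "2 * K"] by simp
  next
    case (Suc n)
    define m where "m = 2 * (n + K)"
    have "m \<ge> K" "2 * (Suc n + K) = Suc (Suc m)" by (auto simp: m_def)
    then show ?case
      using Suc K(1)[of "Suc m"] K(1)[of "Suc (Suc m)"] K(2)[of "Suc m"] K(2)[of "Suc (Suc m)"]
      by (auto simp: m_def[symmetric])
  qed
  have side': "(u (2 * (n + K)) \<le> z) = (u (2 * K) < z)" "(z \<le> u (2 * (n + K) + 1)) = (u (2 * K) < z)" for n
    using side[of n] K(1)[of "2 * (n + K)"] K(1)[of "2 * (n + K) + 1"] by auto
  have shift: "cluster_points (\<lambda>n. u (2 * n)) = cluster_points (\<lambda>n. u (2 * (n + K)))"
    "cluster_points (\<lambda>n. u (2 * n + 1)) = cluster_points (\<lambda>n. u (2 * (n + K) + 1))"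
    using cluster_points_shift[of "\<lambda>n. u (2 * n)" K] cluster_points_shift[of "\<lambda>n. u (2 * n + 1)" K]
    by auto
  have "weakly_separated z (cluster_points (\<lambda>n. u (2 * n))) (cluster_points (\<lambda>n. u (2 * n + 1)))"
  proof (cases "u (2 * K) < z")
    case True
    then have "cluster_points (\<lambda>n. u (2 * n)) \<subseteq> {..z}" "cluster_points (\<lambda>n. u (2 * n + 1)) \<subseteq> {z..}"
      unfolding shift by (intro cluster_points_subset; use side' in simp)+
    then show ?thesis unfolding weakly_separated_def by blast
  next
    case False
    then have "z \<le> u (2 * (n + K))" "u (2 * (n + K) + 1) \<le> z" for n
      using side[of n] by auto
    then have "cluster_points (\<lambda>n. u (2 * n)) \<subseteq> {z..}" "cluster_points (\<lambda>n. u (2 * n + 1)) \<subseteq> {..z}"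
      unfolding shift by (intro cluster_points_subset; simp)+
    then show ?thesis unfolding weakly_separated_def by blast
  qed
  then show ?thesis using z by blast
qed

end

section \<open>The tower of pieces of a limit set\<close>

text \<open>For a nonempty bounded set this is the length of the convex hull.\<close>

definition width :: "real set \<Rightarrow> real" where
  "width S = Sup S - Inf S"

lemma dist_le_width:
  assumes "S \<subseteq> {a..b}" "x \<in> S" "y \<in> S" shows "dist x y \<le> width S"
proof -
  have "bdd_above S" "bdd_below S" using assms(1) by (meson bdd_above_mono bdd_above_Icc, meson bdd_below_mono bdd_below_Icc)
  then have "x \<le> Sup S" "y \<le> Sup S" "Inf S \<le> x" "Inf S \<le> y"
    using assms(2,3) by (simp_all add: cSup_upper cInf_lower)
  then show ?thesis by (auto simp: width_def dist_real_def)
qed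

lemma width_nonneg: "S \<subseteq> {a..b} \<Longrightarrow> S \<noteq> {} \<Longrightarrow> 0 \<le> width S"
  using dist_le_width by (metis all_not_in_conv dist_self)

text \<open>The two hulls share at most the point \<open>z\<close>, and both lie in the hull of the
  union.\<close>

lemma width_weakly_separated:
  assumes sub: "S \<union> T \<subseteq> {a..b}" and ne: "S \<noteq> {}" "T \<noteq> {}" and sep: "weakly_separated z S T"
  shows "width S + width T \<le> width (S \<union> T)"
proof -
  have bdd: "bdd_above (S \<union> T)" "bdd_below (S \<union> T)"
    using sub by (meson bdd_above_mono bdd_above_Icc, meson bdd_below_mono bdd_below_Icc)
  have "Inf (S \<union> T) \<le> Inf S" "Inf (S \<union> T) \<le> Inf T" "Sup S \<le> Sup (S \<union> T)" "Sup T \<le> Sup (S \<union> T)"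
    using ne bdd by (simp_all add: cInf_superset_mono cSup_subset_mono)
  moreover have "(Sup S \<le> z \<and> z \<le> Inf T) \<or> (Sup T \<le> z \<and> z \<le> Inf S)"
  proof -
    have "Sup A \<le> z" if "A \<noteq> {}" "\<forall>s\<in>A. s \<le> z" for A using that by (intro cSup_least) auto
    moreover have "z \<le> Inf A" if "A \<noteq> {}" "\<forall>s\<in>A. z \<le> s" for A using that by (intro cInf_greatest) auto
    ultimately show ?thesis using sep ne unfolding weakly_separated_def by simp metis
  qed
  ultimately show ?thesis by (auto simp: width_def)
qed

lemma weakly_separated_subset:
  "weakly_separated z S T \<Longrightarrow> S' \<subseteq> S \<Longrightarrow> T' \<subseteq> T \<Longrightarrow> weakly_separated z S' T'"
  unfolding weakly_separated_def by (metis subsetD)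

lemma weakly_separated_commute: "weakly_separated z S T \<longleftrightarrow> weakly_separated z T S"
  unfolding weakly_separated_def by auto

context interval_map
begin

text \<open>The \<open>\<omega>\<close>-limit set of \<open>f\<^sup>i x\<close> under \<open>f\<^sup>p\<close>; in particular \<open>piece x 1 0\<close> is that of \<open>x\<close> under \<open>f\<close>.\<close>

definition piece :: "real \<Rightarrow> nat \<Rightarrow> nat \<Rightarrow> real set" where
  "piece x p i = cluster_points (\<lambda>k. (f ^^ (i + p * k)) x)"

lemma piece_subset: "x \<in> {a..b} \<Longrightarrow> piece x p i \<subseteq> {a..b}"
  unfolding piece_def by (rule cluster_points_subset) (use funpow_in in auto)

lemma closed_piece: "closed (piece x p i)"
  unfolding piece_def by (rule closed_cluster_points)

lemma compact_piece: "x \<in> {a..b} \<Longrightarrow> compact (piece x p i)"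
  using compact_Int_closed[OF compact_Icc closed_piece] piece_subset by (metis inf.absorb2)

lemma piece_nonempty: "x \<in> {a..b} \<Longrightarrow> piece x p i \<noteq> {}"
  using cluster_point_exists[of "{a..b}" "\<lambda>k. (f ^^ (i + p * k)) x"] funpow_in
  unfolding piece_def by blast

lemma image_piece: "x \<in> {a..b} \<Longrightarrow> f ` piece x p i = piece x p (Suc i)"
  unfolding piece_def
  using cluster_points_image[OF compact_Icc[of a b], where u = "\<lambda>k. (f ^^ (i + p * k)) x" and f = f]
    cont funpow_in by simp

lemma funpow_image_piece: "x \<in> {a..b} \<Longrightarrow> (f ^^ j) ` piece x p i = piece x p (i + j)"
proof (induction j)
  case (Suc j)
  have "(f ^^ Suc j) ` piece x p i = f ` (f ^^ j) ` piece x p i" by (simp add: image_image)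
  then show ?case using Suc image_piece by simp
qed simp

lemma piece_add_period: "piece x p (i + p) = piece x p i"
  using cluster_points_shift[of "\<lambda>k. (f ^^ (i + p * k)) x" 1] by (simp add: piece_def add.assoc)

lemma piece_mod: "piece x p (i mod p) = piece x p i"
proof -
  have "piece x p (j + p * m) = piece x p j" for j m
  proof (induction m)
    case (Suc m)
    have "piece x p (j + p * Suc m) = piece x p ((j + p * m) + p)" by (simp add: algebra_simps)
    then show ?case using Suc piece_add_period by simp
  qed simp
  from this[of "i mod p" "i div p"] show ?thesis by simp
qed

lemma piece_double: "piece x p i = piece x (2 * p) i \<union> piece x (2 * p) (i + p)"
  using cluster_points_even_odd[of "\<lambda>k. (f ^^ (i + p * k)) x"] by (simp add: piece_def algebra_simps)

lemma piece_Union: "piece x 1 0 = (\<Union>i<2 ^ n. piece x (2 ^ n) i)"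
proof (induction n)
  case (Suc n)
  have split: "{..<2 * 2 ^ n} = {..<2 ^ n} \<union> (\<lambda>i. i + 2 ^ n) ` {..<2 ^ n :: nat}"
  proof (intro antisym subsetI)
    fix i :: nat assume "i \<in> {..<2 * 2 ^ n}"
    then show "i \<in> {..<2 ^ n} \<union> (\<lambda>i. i + 2 ^ n) ` {..<2 ^ n}"
      by (cases "i < 2 ^ n") (auto intro!: image_eqI[where x = "i - 2 ^ n"])
  qed auto
  have "(\<Union>i<2 ^ n. piece x (2 ^ n) i) = (\<Union>i<2 ^ n. piece x (2 * 2 ^ n) i \<union> piece x (2 * 2 ^ n) (i + 2 ^ n))"
    by (intro SUP_cong refl piece_double)
  also have "\<dots> = (\<Union>i<2 * 2 ^ n. piece x (2 * 2 ^ n) i)" unfolding split by auto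
  finally show ?case using Suc by simp
next
  case 0
  have "{..<2 ^ 0} = {0 :: nat}" by auto
  then show ?case by simp
qed

text \<open>\<open>f ^^ (2 ^ n)\<close> maps the two halves of a piece onto each other, so one is
  finite only if both are. This keeps the splitting applicable at every level.\<close>

lemma infinite_piece:
  assumes x: "x \<in> {a..b}" and inf: "infinite (piece x 1 0)"
  shows "infinite (piece x (2 ^ n) i)"
proof (induction n arbitrary: i)
  case 0
  then show ?case using inf piece_mod[of x 1 i] by simp
next
  case (Suc n)
  show ?case
  proof
    assume fin: "finite (piece x (2 ^ Suc n) i)"
    then have "finite (piece x (2 ^ Suc n) (i + 2 ^ n))"
      using funpow_image_piece[OF x, of "2 ^ n" "2 ^ Suc n" i] by (metis finite_imageI)
    then have "finite (piece x (2 ^ n) i)" using fin piece_double[of x "2 ^ n" i] by simp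
    then show False using Suc by blast
  qed
qed

text \<open>A piece is the limit set of \<open>(f ^^ i) x\<close> under \<open>f ^^ (2 ^ n)\<close>,
  which is again horseshoe free; its halves belong to the even and the odd times.\<close>

lemma piece_halves_separated:
  assumes free: "horseshoe_free a b f" and x: "x \<in> {a..b}" and inf: "infinite (piece x 1 0)"
  shows "\<exists>z. (f ^^ (2 ^ n)) z = z \<and> weakly_separated z (piece x (2 ^ Suc n) i) (piece x (2 ^ Suc n) (i + 2 ^ n))"
proof -
  interpret g: interval_map a b "f ^^ (2 ^ n)" by (rule interval_map_funpow)
  have orbit: "((f ^^ (2 ^ n)) ^^ k) ((f ^^ i) x) = (f ^^ (i + 2 ^ n * k)) x" for k
    by (simp add: funpow_mult funpow_add mult.commute add.commute[of i])
  have "infinite (cluster_points (\<lambda>k. ((f ^^ (2 ^ n)) ^^ k) ((f ^^ i) x)))"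
    using infinite_piece[OF x inf, of n i] by (simp add: orbit piece_def)
  from g.even_odd_weakly_separated[OF horseshoe_free_funpow[OF free] funpow_in[OF x] this]
  show ?thesis unfolding orbit by (auto simp: piece_def algebra_simps)
qed

text \<open>At the first level where the residues differ, the pieces are the halves of one common
  piece; later levels inherit the separation. That \<open>z\<close> is periodic is recorded because
  it keeps \<open>z\<close> out of infinite minimal sets.\<close>

lemma pieces_separated:
  assumes free: "horseshoe_free a b f" and x: "x \<in> {a..b}" and inf: "infinite (piece x 1 0)"
    and "i mod 2 ^ n \<noteq> j mod 2 ^ n"
  shows "\<exists>z. \<exists>r\<ge>1. (f ^^ r) z = z \<and> weakly_separated z (piece x (2 ^ n) i) (piece x (2 ^ n) j)"
  using assms(4)
proof (induction n arbitrary: i j)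
  case (Suc n)
  have sub: "piece x (2 ^ Suc n) i \<subseteq> piece x (2 ^ n) i" for i using piece_double[of x "2 ^ n" i] by auto
  show ?case
  proof (cases "i mod 2 ^ n = j mod 2 ^ n")
    case False
    then show ?thesis using Suc.IH weakly_separated_subset sub by meson
  next
    case True
    define l where "l = i mod 2 ^ n"
    have cases: "m mod 2 ^ Suc n = l \<or> m mod 2 ^ Suc n = l + 2 ^ n" if "m mod 2 ^ n = l" for m
    proof -
      have "m mod 2 ^ Suc n = 2 ^ n * (m div 2 ^ n mod 2) + l"
        using that mod_mult2_eq[of m "2 ^ n" 2] by (simp add: mult.commute)
      moreover have "m div 2 ^ n mod 2 = 0 \<or> m div 2 ^ n mod 2 = 1" by auto
      ultimately show ?thesis by (elim disjE) auto
    qed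
    obtain z where z: "(f ^^ (2 ^ n)) z = z"
      "weakly_separated z (piece x (2 ^ Suc n) l) (piece x (2 ^ Suc n) (l + 2 ^ n))"
      using piece_halves_separated[OF free x inf] by blast
    have "i mod 2 ^ Suc n = l \<and> j mod 2 ^ Suc n = l + 2 ^ n \<or> j mod 2 ^ Suc n = l \<and> i mod 2 ^ Suc n = l + 2 ^ n"
      using cases[of i] cases[of j] True Suc.prems l_def by auto
    then have "weakly_separated z (piece x (2 ^ Suc n) i) (piece x (2 ^ Suc n) j)"
      using z(2) piece_mod[of x "2 ^ Suc n" i] piece_mod[of x "2 ^ Suc n" j] weakly_separated_commute by metis
    then show ?thesis using z(1) by (intro exI[where x = z] exI[where x = "2 ^ n"]) simp
  qed
qed simp

lemma sum_width_pieces: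
  assumes free: "horseshoe_free a b f" and x: "x \<in> {a..b}" and inf: "infinite (piece x 1 0)"
  shows "(\<Sum>i<2 ^ n. width (piece x (2 ^ n) i)) \<le> b - a"
proof (induction n)
  case 0
  have "piece x 1 0 \<noteq> {}" "piece x 1 0 \<subseteq> {a..b}" using piece_nonempty piece_subset x by auto
  then have "Sup (piece x 1 0) \<le> b" "a \<le> Inf (piece x 1 0)"
    by (auto intro!: cSup_least cInf_greatest)
  then show ?case by (simp add: width_def)
next
  case (Suc n)
  let ?w = "\<lambda>i. width (piece x (2 * 2 ^ n) i)"
  \<comment> \<open>Cutting the range at \<open>2 ^ n\<close> pairs \<open>i\<close> with
    \<open>i + 2 ^ n\<close>, the indices of the two halves of
    \<open>piece x (2 ^ n) i\<close>.\<close>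
  have "(\<Sum>i<2 * 2 ^ n. ?w i) = (\<Sum>i<2 ^ n. ?w i) + (\<Sum>i=2 ^ n..<2 ^ n + 2 ^ n. ?w i)"
    unfolding lessThan_atLeast0 by (subst sum.atLeastLessThan_concat) (auto simp: mult_2)
  also have "(\<Sum>i=2 ^ n..<2 ^ n + 2 ^ n. ?w i) = (\<Sum>i<2 ^ n. ?w (i + 2 ^ n))"
    using sum.shift_bounds_nat_ivl[of ?w 0 "2 ^ n" "2 ^ n"] by (simp add: lessThan_atLeast0)
  also have "(\<Sum>i<2 ^ n. ?w i) + \<dots> = (\<Sum>i<2 ^ n. ?w i + ?w (i + 2 ^ n))" by (simp add: sum.distrib)
  also have "\<dots> \<le> (\<Sum>i<2 ^ n. width (piece x (2 ^ n) i))"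
  proof (rule sum_mono)
    fix i
    obtain z where "weakly_separated z (piece x (2 * 2 ^ n) i) (piece x (2 * 2 ^ n) (i + 2 ^ n))"
      using piece_halves_separated[OF free x inf] by auto
    then show "?w i + ?w (i + 2 ^ n) \<le> width (piece x (2 ^ n) i)"
      unfolding piece_double[of x "2 ^ n" i]
      using width_weakly_separated piece_subset[OF x] piece_nonempty[OF x] by (metis Un_least)
  qed
  finally show ?case using Suc by simp
qed

text \<open>Each of the \<open>p\<close> residue classes has its own threshold; the maximum of these
  serves all times.\<close>

lemma eventually_near_piece:
  assumes x: "x \<in> {a..b}" and p: "p > 0" and e: "e > 0"
  shows "\<exists>N. \<forall>n\<ge>N. \<exists>y\<in>piece x p n. dist ((f ^^ n) x) y < e"
proof -
  have "\<exists>N. \<forall>k\<ge>N. \<exists>y\<in>piece x p i. dist ((f ^^ (i + p * k)) x) y < e" for i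
    unfolding piece_def by (rule eventually_near_cluster_points[OF compact_Icc _ e]) (rule funpow_in[OF x])
  then obtain N where N: "\<And>i k. k \<ge> N i \<Longrightarrow> \<exists>y\<in>piece x p i. dist ((f ^^ (i + p * k)) x) y < e" by metis
  define M where "M = Max (N ` {..<p})"
  have "\<exists>y\<in>piece x p n. dist ((f ^^ n) x) y < e" if "n \<ge> p * M" for n
  proof -
    have "n mod p < p" using p by simp
    then have "N (n mod p) \<le> M" unfolding M_def by (intro Max_ge) auto
    also have "M \<le> n div p" using that p by (metis div_le_mono nonzero_mult_div_cancel_left not_gr_zero)
    finally show ?thesis using N[of "n mod p" "n div p"] piece_mod[of x p n] by simp
  qed
  then show ?thesis by blast
qed

end

section \<open>Averages along orbits and minimal sets\<close>

text \<open>The range is covered by \<open>M div p + 1\<close> full periods; the additional one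
  costs a constant, which vanishes in averages.\<close>

lemma sum_periodic_le:
  fixes h :: "nat \<Rightarrow> real"
  assumes pos: "\<And>m. 0 \<le> h m" and per: "\<And>m. h (m + p) = h m" and p: "p > 0"
  shows "(\<Sum>m<M. h m) \<le> (M / p + 1) * (\<Sum>i<p. h i)"
proof -
  have shift: "h (j + m * p) = h j" for j m
  proof (induction m)
    case (Suc m)
    have "h (j + Suc m * p) = h ((j + m * p) + p)" by (simp add: algebra_simps)
    then show ?case using per Suc by simp
  qed simp
  define q where "q = M div p + 1"
  have "M < q * p" using p dividend_less_div_times[of p M] by (simp add: q_def algebra_simps)
  then have "(\<Sum>m<M. h m) \<le> (\<Sum>m<q * p. h m)" using pos by (intro sum_mono2) auto
  also have "\<dots> = (\<Sum>m<q. \<Sum>i\<in>{m * p..<m * p + p}. h i)" by (rule sum.nat_group[symmetric])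
  also have "\<dots> = (\<Sum>m<q. \<Sum>i<p. h i)"
  proof (rule sum.cong[OF refl])
    fix m
    show "(\<Sum>i\<in>{m * p..<m * p + p}. h i) = (\<Sum>i<p. h i)"
      using sum.shift_bounds_nat_ivl[of h 0 "m * p" p] by (simp add: shift lessThan_atLeast0 add.commute)
  qed
  also have "\<dots> = real q * (\<Sum>i<p. h i)" by simp
  also have "\<dots> \<le> (M / p + 1) * (\<Sum>i<p. h i)"
    using pos by (intro mult_right_mono sum_nonneg) (auto simp: q_def of_nat_div_le_of_nat)
  finally show ?thesis .
qed

text \<open>This estimate serves the distances to an orbit in a finite limit set
  (\<open>h = 0\<close>), the widths of the pieces visited, and the indicator of wide pieces. The
  shift \<open>i\<close> stands for the index of the starting piece.\<close>

lemma limsup_average_le: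
  fixes g h :: "nat \<Rightarrow> real"
  assumes near: "\<And>n. n \<ge> M \<Longrightarrow> g n \<le> \<eta> + h (i + n)" and bound: "\<And>n. g n \<le> B" "B \<ge> 0"
    and pos: "\<And>m. 0 \<le> h m" and per: "\<And>m. h (m + p) = h m" and p: "p > 0" and \<eta>: "\<eta> \<ge> 0"
  shows "limsup (\<lambda>N. ereal ((\<Sum>n=1..N. g n) / real N)) \<le> ereal (\<eta> + (\<Sum>i<p. h i) / p)"
proof -
  define H where "H = (\<Sum>i<p. h i)"
  \<comment> \<open>\<open>C\<close> collects the first \<open>M\<close> terms, the extension of the
    range by \<open>i + 1\<close>, and the additional period.\<close>
  define C where "C = M * B + ((i + 1) / p + 1) * H"
  have le: "(\<Sum>n=1..N. g n) \<le> C + N * (\<eta> + H / p)" for N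
  proof -
    have "(\<Sum>n=1..N. g n) \<le> (\<Sum>n=1..N. (if n < M then B else 0) + \<eta> + h (i + n))"
    proof (rule sum_mono)
      fix n
      show "g n \<le> (if n < M then B else 0) + \<eta> + h (i + n)"
        using near[of n] bound(1)[of n] pos[of "i + n"] \<eta> by (cases "n < M") auto
    qed
    also have "\<dots> = (\<Sum>n=1..N. if n < M then B else 0) + N * \<eta> + (\<Sum>n=1..N. h (i + n))"
      by (simp add: sum.distrib)
    also have "(\<Sum>n=1..N. if n < M then B else 0) = (\<Sum>n\<in>{1..N} \<inter> {..<M}. B)"
      by (subst sum.inter_restrict) auto
    also have "\<dots> \<le> M * B"
      using card_mono[of "{..<M}" "{1..N} \<inter> {..<M}"] bound(2) by (simp add: mult_right_mono)
    also have "(\<Sum>n=1..N. h (i + n)) = (\<Sum>n\<in>(\<lambda>n. i + n) ` {1..N}. h n)"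
      by (subst sum.reindex) auto
    also have "\<dots> \<le> (\<Sum>n<N + i + 1. h n)" using pos by (intro sum_mono2) auto
    also have "\<dots> \<le> (real (N + i + 1) / p + 1) * H"
      unfolding H_def by (rule sum_periodic_le) (use pos per p in auto)
    finally show ?thesis by (simp add: C_def algebra_simps add_divide_distrib)
  qed
  have "eventually (\<lambda>N. ereal ((\<Sum>n=1..N. g n) / real N) \<le> ereal (C / real N + (\<eta> + H / p))) sequentially"
    using eventually_gt_at_top[of "0 :: nat"]
  proof eventually_elim
    case (elim N)
    have "(\<Sum>n=1..N. g n) / real N \<le> (C + N * (\<eta> + H / p)) / real N"
      using le[of N] by (intro divide_right_mono) auto
    then show ?case using elim by (simp add: add_divide_distrib)
  qed
  then have "limsup (\<lambda>N. ereal ((\<Sum>n=1..N. g n) / real N)) \<le> limsup (\<lambda>N. ereal (C / real N + (\<eta> + H / p)))"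
    by (rule Limsup_mono)
  also have "\<dots> = ereal (\<eta> + H / p)"
  proof (rule lim_imp_Limsup)
    have "(\<lambda>N. C / real N + (\<eta> + H / p)) \<longlonglongrightarrow> 0 + (\<eta> + H / p)"
      by (intro tendsto_add tendsto_const lim_const_over_n)
    then show "(\<lambda>N. ereal (C / real N + (\<eta> + H / p))) \<longlonglongrightarrow> ereal (\<eta> + H / p)" by simp
  qed simp
  finally show ?thesis by (simp add: H_def)
qed

lemma mean_L_stable_finite:
  fixes K :: "'a::heine_borel set"
  assumes "finite K" shows "mean_L_stable K f"
  unfolding mean_L_stable_def
proof (intro allI impI)
  fix \<epsilon> :: real assume \<epsilon>: "\<epsilon> > 0"
  obtain \<delta> where "\<delta> > 0" "\<forall>x\<in>K. \<forall>y\<in>K. dist x y < \<delta> \<longrightarrow> x = y"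
    using assms uniform_discrete_finite_iff[of K] unfolding uniform_discrete_def by metis
  moreover have "upper_density {} < ereal \<epsilon>" using \<epsilon> by (simp add: upper_density_def Limsup_const)
  moreover have "\<forall>n\<in>{1..} - {}. dist ((f ^^ n) x) ((f ^^ n) x) < \<epsilon>" for x using \<epsilon> by simp
  ultimately show "\<exists>\<delta>>0. \<forall>x\<in>K. \<forall>y\<in>K. dist x y < \<delta> \<longrightarrow>
      (\<exists>E. E \<subseteq> {1..} \<and> upper_density E < ereal \<epsilon> \<and>
        (\<forall>n\<in>{1..} - E. dist ((f ^^ n) x) ((f ^^ n) y) < \<epsilon>))"
    by (metis empty_subsetI)
qed

section \<open>Minimal sets, mean attraction and mean stability\<close>

context interval_map
begin

lemma minimal_funpow_in: "minimal_subset {a..b} f K \<Longrightarrow> x \<in> K \<Longrightarrow> (f ^^ n) x \<in> K"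
  by (induction n) (auto simp: minimal_subset_def)

text \<open>Zorn's lemma yields maximal elements, so it is applied to the complements of the
  nonempty closed invariant subsets of \<open>W\<close>. Compactness keeps the intersection of a
  chain nonempty.\<close>

lemma minimal_subset_exists:
  assumes W: "W \<subseteq> {a..b}" "closed W" "W \<noteq> {}" "f ` W \<subseteq> W"
  shows "\<exists>K\<subseteq>W. K \<noteq> {} \<and> minimal_subset {a..b} f K"
proof -
  define \<A> where "\<A> = {C. closed C \<and> C \<noteq> {} \<and> C \<subseteq> W \<and> f ` C \<subseteq> C}"
  have "\<exists>M\<in>uminus ` \<A>. \<forall>X\<in>uminus ` \<A>. M \<subseteq> X \<longrightarrow> X = M"
  proof (rule subset_Zorn_nonempty)
    show "uminus ` \<A> \<noteq> {}" using W by (auto simp: \<A>_def)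
  next
    fix \<C> assume \<C>: "\<C> \<noteq> {}" "subset.chain (uminus ` \<A>) \<C>"
    define \<F> where "\<F> = uminus ` \<C>"
    have \<F>: "\<F> \<subseteq> \<A>" "\<F> \<noteq> {}" using \<C> by (auto simp: \<F>_def subset_chain_def)
    have "\<Inter> \<F> \<noteq> {}"
    proof (rule compact_chain)
      show "compact S" if "S \<in> \<F>" for S
      proof -
        have "closed S" "{a..b} \<inter> S = S" using that \<F> W(1) by (auto simp: \<A>_def)
        then show ?thesis using compact_Int_closed[OF compact_Icc[of a b], of S] by simp
      qed
      show "{} \<notin> \<F>" using \<F> by (auto simp: \<A>_def)
      show "S \<subseteq> T \<or> T \<subseteq> S" if "S \<in> \<F> \<and> T \<in> \<F>" for S T
        using that \<C>(2) unfolding \<F>_def subset_chain_def by (metis Compl_subset_Compl_iff imageE)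
    qed
    moreover have "f ` S \<subseteq> S" if "S \<in> \<F>" for S using that \<F> by (auto simp: \<A>_def)
    then have "f ` \<Inter> \<F> \<subseteq> \<Inter> \<F>" by blast
    moreover have "closed (\<Inter> \<F>)" "\<Inter> \<F> \<subseteq> W" using \<F> by (auto simp: \<A>_def)
    ultimately have "\<Inter> \<F> \<in> \<A>" by (simp add: \<A>_def)
    moreover have "\<Union> \<C> = - \<Inter> \<F>" by (auto simp: \<F>_def)
    ultimately show "\<Union> \<C> \<in> uminus ` \<A>" by blast
  qed
  then obtain K where K: "K \<in> \<A>" and min: "\<And>C. C \<in> \<A> \<Longrightarrow> C \<subseteq> K \<Longrightarrow> C = K" by auto
  have "closure {(f ^^ n) x |n. n \<ge> 1} = K" if x: "x \<in> K" for x
  proof (rule min)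
    let ?O = "{(f ^^ n) x |n. n \<ge> 1}"
    have "(f ^^ n) x \<in> K" for n using K x by (induction n) (auto simp: \<A>_def)
    then show sub: "closure ?O \<subseteq> K" using K by (intro closure_minimal) (auto simp: \<A>_def)
    have "f ` closure ?O \<subseteq> closure ?O"
    proof (rule image_closure_subset)
      show "continuous_on (closure ?O) f"
        using continuous_on_subset[OF cont] sub K W(1) unfolding \<A>_def by blast
      have "f ` ?O \<subseteq> ?O"
      proof clarify
        fix n :: nat assume "n \<ge> 1"
        show "\<exists>m. f ((f ^^ n) x) = (f ^^ m) x \<and> m \<ge> 1" by (rule exI[where x = "Suc n"]) simp
      qed
      then show "f ` ?O \<subseteq> closure ?O" using closure_subset by (rule order_trans)
    qed simp
    moreover have "f x \<in> ?O" by (rule CollectI, rule exI[where x = 1]) simp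
    then have "f x \<in> closure ?O" by (rule subsetD[OF closure_subset])
    moreover have "closure ?O \<subseteq> W" using sub K by (auto simp: \<A>_def)
    ultimately show "closure ?O \<in> \<A>" unfolding \<A>_def by blast
  qed
  then have "minimal_subset {a..b} f K" using K W(1) by (auto simp: minimal_subset_def \<A>_def)
  then show ?thesis using K by (auto simp: \<A>_def)
qed

text \<open>The image of \<open>K\<close> is closed and contains the orbit of each point of
  \<open>K\<close> from time 1 on, hence its closure \<open>K\<close>. Surjectivity supplies points
  of \<open>K\<close> with a prescribed later position.\<close>

lemma image_minimal:
  assumes K: "minimal_subset {a..b} f K" shows "(f ^^ n) ` K = K"
proof (induction n)
  case (Suc n)
  have "K \<subseteq> f ` K"
  proof
    fix x assume x: "x \<in> K"
    have "compact K" using K compact_Int_closed[OF compact_Icc, of K a b]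
      unfolding minimal_subset_def by (metis inf.absorb2)
    then have "closed (f ` K)"
      using K continuous_on_subset[OF cont] compact_continuous_image compact_imp_closed
      unfolding minimal_subset_def by blast
    moreover have "(f ^^ n) x \<in> f ` K" if "n \<ge> 1" for n
      using minimal_funpow_in[OF K x] that by (cases n) auto
    ultimately have "closure {(f ^^ n) x |n. n \<ge> 1} \<subseteq> f ` K" by (intro closure_minimal) auto
    then show "x \<in> f ` K" using K x unfolding minimal_subset_def by blast
  qed
  then have "f ` K = K" using K unfolding minimal_subset_def by blast
  moreover have "(f ^^ Suc n) ` K = f ` (f ^^ n) ` K" by (simp add: image_image)
  ultimately show ?case using Suc by simp
qed simp

lemma piece_one: "piece x 1 i = piece x 1 0"
  using piece_mod[of x 1 i] by simp

lemma image_piece_one: "x \<in> {a..b} \<Longrightarrow> f ` piece x 1 0 = piece x 1 0"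
  by (simp only: image_piece piece_one[of x "Suc 0"])

lemma minimal_eq_piece:
  assumes K: "minimal_subset {a..b} f K" and x: "x \<in> K"
  shows "piece x 1 0 = K"
proof
  have K': "K \<subseteq> {a..b}" "closed K" using K by (auto simp: minimal_subset_def)
  then have x_in: "x \<in> {a..b}" using x by blast
  show sub: "piece x 1 0 \<subseteq> K"
    unfolding piece_def by (rule cluster_points_subset) (use K' minimal_funpow_in[OF K x] in auto)
  obtain y where y: "y \<in> piece x 1 0" using piece_nonempty[OF x_in] by blast
  have "(f ^^ n) ` piece x 1 0 = piece x 1 0" for n
    by (simp only: funpow_image_piece[OF x_in] piece_one[of x "0 + n"])
  then have "(f ^^ n) y \<in> piece x 1 0" for n using y by blast
  then have "closure {(f ^^ n) y |n. n \<ge> 1} \<subseteq> piece x 1 0"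
    by (intro closure_minimal closed_piece) auto
  then show "K \<subseteq> piece x 1 0" using K y sub unfolding minimal_subset_def by blast
qed

lemma minimal_periodic_finite:
  assumes K: "minimal_subset {a..b} f K" and z: "z \<in> K" "(f ^^ r) z = z" "r \<ge> 1"
  shows "finite K"
proof -
  have "{(f ^^ n) z |n. n \<ge> 1} \<subseteq> (\<lambda>n. (f ^^ n) z) ` {..<r}"
  proof
    fix y assume "y \<in> {(f ^^ n) z |n. n \<ge> 1}"
    then obtain n where "y = (f ^^ n) z" by blast
    then have "y = (f ^^ (n mod r)) z" using funpow_mod_eq[OF z(2)] by simp
    then show "y \<in> (\<lambda>n. (f ^^ n) z) ` {..<r}"
      by (rule image_eqI) (use z(3) in simp)
  qed
  then have fin: "finite {(f ^^ n) z |n. n \<ge> 1}" by (rule finite_subset) simp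
  have "closure {(f ^^ n) z |n. n \<ge> 1} = K" using K z(1) by (simp add: minimal_subset_def)
  then show ?thesis using fin closure_closed[OF finite_imp_closed[OF fin]] by simp
qed

text \<open>Points of a finite limit set are uniformly apart, so an orbit that has come close to the
  orbit of \<open>z\<close> cannot leave it: from then on the distance stays small at every time,
  not only in the mean.\<close>

lemma mean_attracted_finite:
  assumes x: "x \<in> {a..b}" and fin: "finite (piece x 1 0)"
    and K: "minimal_subset {a..b} f K" "K \<subseteq> piece x 1 0" "K \<noteq> {}"
  shows "mean_attracted f K x"
  unfolding mean_attracted_def
proof (intro allI impI)
  fix \<epsilon> :: real assume \<epsilon>: "\<epsilon> > 0"
  let ?W = "piece x 1 0"
  have W: "?W \<subseteq> {a..b}" "f ` ?W = ?W"
    by (rule piece_subset[OF x], rule image_piece_one[OF x])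
  obtain \<delta> where \<delta>: "\<delta> > 0" "\<forall>x\<in>?W. \<forall>y\<in>?W. dist x y < \<delta> \<longrightarrow> x = y"
    using fin uniform_discrete_finite_iff[of ?W] unfolding uniform_discrete_def by metis
  obtain d where d: "d > 0" "\<And>s t. s \<in> {a..b} \<Longrightarrow> t \<in> {a..b} \<Longrightarrow> dist s t < d \<Longrightarrow> dist (f s) (f t) < \<delta> / 2"
    using compact_uniformly_continuous[OF cont compact_Icc] \<delta>(1) unfolding uniformly_continuous_on_def
    by (metis half_gt_zero)
  \<comment> \<open>\<open>d\<close> serves one application of \<open>f\<close>,
    \<open>\<delta> / 2\<close> the identification of a nearby limit point, and
    \<open>\<epsilon> / 2\<close> the conclusion.\<close>
  define \<eta> where "\<eta> = min (min d (\<delta> / 2)) (\<epsilon> / 2)"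
  have \<eta>: "\<eta> > 0" "\<eta> \<le> d" "\<eta> \<le> \<delta> / 2" "\<eta> < \<epsilon>" using d \<delta> \<epsilon> by (auto simp: \<eta>_def)
  obtain N where N: "\<forall>n\<ge>N. \<exists>y\<in>?W. dist ((f ^^ n) x) y < \<eta>"
    using eventually_near_piece[OF x _ \<eta>(1), of 1] by (metis piece_one zero_less_one)
  obtain w where w: "w \<in> K" using K by blast
  then have "w \<in> ?W" using K by blast
  then obtain m where m: "m \<ge> N" "dist ((f ^^ m) x) w < \<eta>"
    using cluster_pointsD[of w "\<lambda>n. (f ^^ n) x" \<eta> N] \<eta>(1) by (auto simp: piece_def)
  \<comment> \<open>Pulling \<open>w\<close> back by \<open>m\<close> steps inside \<open>K\<close>
    synchronises \<open>z\<close> with \<open>x\<close> at time \<open>m\<close>.\<close>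
  obtain z where z: "z \<in> K" "(f ^^ m) z = w" using image_minimal[OF K(1), of m] w by (metis imageE)
  have "(f ^^ n) z \<in> ?W" for n using minimal_funpow_in[OF K(1) z(1)] K(2) by blast
  note zW = this
  then have z_in: "(f ^^ n) z \<in> {a..b}" for n using W(1) by blast
  have near: "dist ((f ^^ n) x) ((f ^^ n) z) < \<eta>" if "n \<ge> m" for n
    using that
  proof (induction n rule: dec_induct)
    case base
    then show ?case using m z by simp
  next
    case (step n)
    have "dist ((f ^^ Suc n) x) ((f ^^ Suc n) z) < \<delta> / 2"
      using d(2)[of "(f ^^ n) x" "(f ^^ n) z"] step \<eta>(2) funpow_in[OF x, of n] z_in[of n] by simp
    \<comment> \<open>The limit point \<open>y\<close> must be the iterate of \<open>z\<close>
      itself, which restores the bound \<open>\<eta>\<close> after the loss to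
      \<open>\<delta> / 2\<close>.\<close>
    moreover obtain y where y: "y \<in> ?W" "dist ((f ^^ Suc n) x) y < \<eta>" using N step m by (metis le_SucI order_trans)
    ultimately have "dist y ((f ^^ Suc n) z) < \<delta>" using \<eta>(3) by metric
    then have "y = (f ^^ Suc n) z" using \<delta>(2) y zW by blast
    then show ?case using y by simp
  qed
  have "limsup (\<lambda>N. ereal ((\<Sum>n=1..N. dist ((f ^^ n) x) ((f ^^ n) z)) / real N))
      \<le> ereal (\<eta> + (\<Sum>i<(1 :: nat). 0) / real 1)"
  proof (rule limsup_average_le[where M = m and B = "b - a" and h = "\<lambda>_. 0" and i = 0])
    show "dist ((f ^^ n) x) ((f ^^ n) z) \<le> b - a" for n
      using funpow_in[OF x, of n] z_in[of n] by (auto simp: dist_real_def abs_le_iff)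
    show "b - a \<ge> 0" using x by simp
  qed (use near \<eta>(1) in \<open>auto intro: less_imp_le\<close>)
  also have "\<dots> < ereal \<epsilon>" using \<eta> by simp
  finally show "\<exists>z\<in>K. limsup (\<lambda>N. ereal ((\<Sum>n=1..N. dist ((f ^^ n) x) ((f ^^ n) z)) / real N)) < ereal \<epsilon>"
    using z by blast
qed

lemma small_inverse_power: "e > 0 \<Longrightarrow> \<exists>n. c / 2 ^ n < (e :: real)"
  using real_arch_pow[of 2 "c / e"] by (auto simp: field_simps)

text \<open>\<open>K\<close> may be smaller than the limit set, but it meets some piece, and moving
  on along the orbit reaches \<open>piece x p 0\<close>; from there \<open>z\<close> is in step with
  \<open>x\<close>. The level \<open>n\<close>, and with it \<open>z\<close>, depends on
  \<open>\<epsilon>\<close>.\<close>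

lemma mean_attracted_infinite:
  assumes free: "horseshoe_free a b f" and x: "x \<in> {a..b}" and inf: "infinite (piece x 1 0)"
    and K: "minimal_subset {a..b} f K" "K \<subseteq> piece x 1 0" "K \<noteq> {}"
  shows "mean_attracted f K x"
  unfolding mean_attracted_def
proof (intro allI impI)
  fix \<epsilon> :: real assume \<epsilon>: "\<epsilon> > 0"
  \<comment> \<open>One half of \<open>\<epsilon>\<close> is for the mean width, the other for the
    distance of the orbit of \<open>x\<close> from the pieces.\<close>
  obtain n where n: "(b - a) / 2 ^ n < \<epsilon> / 2" using small_inverse_power[of "\<epsilon> / 2" "b - a"] \<epsilon> by auto
  define p :: nat where "p = 2 ^ n"
  have p: "p > 0" by (simp add: p_def)
  obtain w where w: "w \<in> K" using K by blast
  then obtain i where i: "i < p" "w \<in> piece x p i" using K piece_Union[of x n] by (auto simp: p_def)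
  define z where "z = (f ^^ (p - i)) w"
  have "z \<in> piece x p (i + (p - i))"
    using i funpow_image_piece[OF x, of "p - i" p i] by (auto simp: z_def)
  then have z_piece: "z \<in> piece x p 0" using i piece_add_period[of x p 0] by simp
  have z: "z \<in> K" unfolding z_def by (rule minimal_funpow_in[OF K(1) w])
  have z_orbit: "(f ^^ m) z \<in> piece x p m" for m
    using z_piece funpow_image_piece[OF x, of m p 0] by auto
  have sub: "piece x p m \<subseteq> {a..b}" for m by (rule piece_subset[OF x])
  obtain N where N: "\<And>m. m \<ge> N \<Longrightarrow> \<exists>y\<in>piece x p m. dist ((f ^^ m) x) y < \<epsilon> / 2"
    using eventually_near_piece[OF x p, of "\<epsilon> / 2"] \<epsilon> by auto
  have "limsup (\<lambda>N. ereal ((\<Sum>n=1..N. dist ((f ^^ n) x) ((f ^^ n) z)) / real N))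
      \<le> ereal (\<epsilon> / 2 + (\<Sum>i<p. width (piece x p i)) / p)"
  proof (rule limsup_average_le[where M = N and B = "b - a" and i = 0])
    fix m
    show "dist ((f ^^ m) x) ((f ^^ m) z) \<le> b - a"
      using funpow_in[OF x, of m] z_orbit[of m] sub[of m] by (auto simp: dist_real_def abs_le_iff)
    show "0 \<le> width (piece x p m)" using width_nonneg[OF sub] piece_nonempty[OF x] by blast
    show "width (piece x p (m + p)) = width (piece x p m)" by (simp add: piece_add_period)
    assume "N \<le> m"
    then obtain y where y: "y \<in> piece x p m" "dist ((f ^^ m) x) y < \<epsilon> / 2" using N by blast
    have "dist y ((f ^^ m) z) \<le> width (piece x p m)" by (rule dist_le_width[OF sub y(1) z_orbit])
    then show "dist ((f ^^ m) x) ((f ^^ m) z) \<le> \<epsilon> / 2 + width (piece x p (0 + m))"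
      using y(2) dist_triangle[of "(f ^^ m) x" "(f ^^ m) z" y] by simp
  qed (use x p \<epsilon> in auto)
  also have "\<dots> < ereal \<epsilon>"
  proof -
    have "(\<Sum>i<p. width (piece x p i)) / p \<le> (b - a) / p"
      using sum_width_pieces[OF free x inf, of n] by (intro divide_right_mono) (auto simp: p_def)
    moreover have "(b - a) / p < \<epsilon> / 2" using n by (simp add: p_def)
    ultimately have "\<epsilon> / 2 + (\<Sum>i<p. width (piece x p i)) / p < \<epsilon>" by linarith
    then show ?thesis by simp
  qed
  finally show "\<exists>z\<in>K. limsup (\<lambda>N. ereal ((\<Sum>n=1..N. dist ((f ^^ n) x) ((f ^^ n) z)) / real N)) < ereal \<epsilon>"
    using z by blast
qed

lemma minimally_mean_attractable_if_horseshoe_free: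
  assumes free: "horseshoe_free a b f"
  shows "minimally_mean_attractable {a..b} f"
proof -
  have "\<exists>K. minimal_subset {a..b} f K \<and> x \<in> basin {a..b} f K" if x: "x \<in> {a..b}" for x
  proof -
    have "f ` piece x 1 0 \<subseteq> piece x 1 0" using image_piece_one[OF x] by simp
    then obtain K where K: "K \<subseteq> piece x 1 0" "K \<noteq> {}" "minimal_subset {a..b} f K"
      using minimal_subset_exists piece_subset[OF x] closed_piece piece_nonempty[OF x] by metis
    then have "mean_attracted f K x"
      using mean_attracted_finite mean_attracted_infinite free x by blast
    then show ?thesis using K x by (auto simp: basin_def)
  qed
  then show ?thesis unfolding minimally_mean_attractable_def basin_def by blast
qed

lemma minimally_mean_L_stable_if_horseshoe_free:
  assumes free: "horseshoe_free a b f"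
  shows "minimally_mean_L_stable {a..b} f"
  unfolding minimally_mean_L_stable_def
proof (intro allI impI)
  fix K assume K: "minimal_subset {a..b} f K"
  show "mean_L_stable K f"
  proof (cases "finite K")
    case True
    then show ?thesis by (rule mean_L_stable_finite)
  next
    case False
    then obtain x where x: "x \<in> K" by fastforce
    then have x_in: "x \<in> {a..b}" using K by (auto simp: minimal_subset_def)
    have K_eq: "piece x 1 0 = K" by (rule minimal_eq_piece[OF K x])
    have inf: "infinite (piece x 1 0)" using False K_eq by simp
    show ?thesis unfolding mean_L_stable_def
    proof (intro allI impI)
      fix \<epsilon> :: real assume \<epsilon>: "\<epsilon> > 0"
      \<comment> \<open>At most \<open>(b - a) / \<epsilon>\<close> of the \<open>2 ^ n\<close>
        pieces have width at least \<open>\<epsilon>\<close>, so the times spent in them have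
        density below \<open>\<epsilon>\<close>.\<close>
      obtain n where n: "(b - a) / \<epsilon> / 2 ^ n < \<epsilon>" using small_inverse_power[OF \<epsilon>] by blast
      define p :: nat where "p = 2 ^ n"
      have p: "p > 0" by (simp add: p_def)
      have sub: "piece x p m \<subseteq> {a..b}" for m by (rule piece_subset[OF x_in])
      have width_pos: "0 \<le> width (piece x p m)" for m using width_nonneg[OF sub] piece_nonempty[OF x_in] by blast
      have in_K: "piece x p i \<subseteq> K" if "i < p" for i using K_eq piece_Union[of x n] that by (auto simp: p_def)
      \<comment> \<open>Weak separation leaves only the periodic point \<open>z\<close> as a
        possible common point.\<close>
      have disj: "piece x p i \<inter> piece x p j = {}" if ij: "i < p" "j < p" "i \<noteq> j" for i j
      proof (rule ccontr)
        assume "piece x p i \<inter> piece x p j \<noteq> {}"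
        then obtain y where y: "y \<in> piece x p i" "y \<in> piece x p j" by blast
        have "i mod 2 ^ n \<noteq> j mod 2 ^ n" using ij by (simp add: p_def)
        then obtain z r where z: "r \<ge> 1" "(f ^^ r) z = z" "weakly_separated z (piece x p i) (piece x p j)"
          using pieces_separated[OF free x_in inf] unfolding p_def by blast
        then have "y = z" using y unfolding weakly_separated_def by force
        then have "z \<in> K" using y in_K ij by blast
        then show False using minimal_periodic_finite[OF K _ z(2,1)] False by blast
      qed
      have "\<exists>d>0. \<forall>s\<in>piece x p i. \<forall>t\<in>piece x p j. d \<le> dist s t" if "i < p" "j < p" "i \<noteq> j" for i j
        using separate_compact_closed[OF compact_piece[OF x_in] closed_piece disj[OF that]] .
      then obtain d where d: "\<And>i j. i < p \<Longrightarrow> j < p \<Longrightarrow> i \<noteq> j \<Longrightarrow>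
        d i j > 0 \<and> (\<forall>s\<in>piece x p i. \<forall>t\<in>piece x p j. d i j \<le> dist s t)" by metis
      \<comment> \<open>The element 1 keeps \<open>Min D\<close> meaningful when there is only one
        piece.\<close>
      define D where "D = insert 1 {d i j |i j. i < p \<and> j < p \<and> i \<noteq> j}"
      have "{d i j |i j. i < p \<and> j < p \<and> i \<noteq> j} \<subseteq> (\<lambda>(i, j). d i j) ` ({..<p} \<times> {..<p})" by auto
      then have fin: "finite D" unfolding D_def by (simp add: finite_subset)
      then have \<delta>: "Min D > 0" using d by (auto simp: D_def)
      have "\<exists>E. E \<subseteq> {1..} \<and> upper_density E < ereal \<epsilon> \<and>
          (\<forall>n\<in>{1..} - E. dist ((f ^^ n) y) ((f ^^ n) z) < \<epsilon>)"
        if yz: "y \<in> K" "z \<in> K" "dist y z < Min D" for y z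
      proof -
        obtain i j where i: "i < p" "y \<in> piece x p i" and j: "j < p" "z \<in> piece x p j"
          using yz K_eq piece_Union[of x n] by (auto simp: p_def)
        have "i = j"
        proof (rule ccontr)
          assume "i \<noteq> j"
          then have "Min D \<le> d i j" using fin i j by (intro Min_le) (auto simp: D_def)
          also have "\<dots> \<le> dist y z" using d i j \<open>i \<noteq> j\<close> by blast
          finally show False using yz by simp
        qed
        define h where "h m = (if \<epsilon> \<le> width (piece x p m) then 1 else 0 :: real)" for m
        define E where "E = {m. 1 \<le> m \<and> h (i + m) = 1}"
        have "dist ((f ^^ m) y) ((f ^^ m) z) < \<epsilon>" if "m \<in> {1..} - E" for m
        proof -
          have "(f ^^ m) y \<in> piece x p (i + m)" "(f ^^ m) z \<in> piece x p (i + m)"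
            using i j \<open>i = j\<close> funpow_image_piece[OF x_in, of m p i] by auto
          then have "dist ((f ^^ m) y) ((f ^^ m) z) \<le> width (piece x p (i + m))" by (rule dist_le_width[OF sub])
          then show ?thesis using that by (auto simp: E_def h_def split: if_splits)
        qed
        moreover have "upper_density E < ereal \<epsilon>"
        proof -
          have "real (card (E \<inter> {1..N})) = (\<Sum>m=1..N. h (i + m))" for N
          proof -
            have "real (card (E \<inter> {1..N})) = (\<Sum>m\<in>{1..N} \<inter> E. 1)" by (simp add: Int_commute)
            also have "\<dots> = (\<Sum>m=1..N. if m \<in> E then 1 else 0)" by (rule sum.inter_restrict) simp
            also have "\<dots> = (\<Sum>m=1..N. h (i + m))" by (rule sum.cong) (auto simp: E_def h_def)
            finally show ?thesis .
          qed
          then have "upper_density E = limsup (\<lambda>N. ereal ((\<Sum>m=1..N. h (i + m)) / real N))"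
            by (simp add: upper_density_def)
          also have "\<dots> \<le> ereal (0 + (\<Sum>i<p. h i) / p)"
            by (rule limsup_average_le[where M = 0 and B = 1 and i = i])
              (use p in \<open>auto simp: h_def piece_add_period\<close>)
          also have "\<dots> < ereal \<epsilon>"
          proof -
            \<comment> \<open>This is Markov's inequality: each wide piece contributes at least
              \<open>\<epsilon>\<close> to the total width.\<close>
            have "\<epsilon> * (\<Sum>i<p. h i) \<le> (\<Sum>i<p. width (piece x p i))"
              unfolding sum_distrib_left by (rule sum_mono) (auto simp: h_def width_pos)
            also have "\<dots> \<le> b - a" using sum_width_pieces[OF free x_in inf, of n] by (simp add: p_def)
            finally have "(\<Sum>i<p. h i) \<le> (b - a) / \<epsilon>" using \<epsilon> by (simp add: field_simps)
            then have "(\<Sum>i<p. h i) / p \<le> (b - a) / \<epsilon> / p" by (intro divide_right_mono) auto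
            then show ?thesis using n by (simp add: p_def)
          qed
          finally show ?thesis .
        qed
        ultimately show ?thesis by (intro exI[where x = E]) (auto simp: E_def)
      qed
      then show "\<exists>\<delta>>0. \<forall>y\<in>K. \<forall>z\<in>K. dist y z < \<delta> \<longrightarrow>
        (\<exists>E. E \<subseteq> {1..} \<and> upper_density E < ereal \<epsilon> \<and>
          (\<forall>n\<in>{1..} - E. dist ((f ^^ n) y) ((f ^^ n) z) < \<epsilon>))"
        using \<delta> by blast
    qed
  qed
qed

end

theorem theorem1:
  fixes a b :: real and f :: "real \<Rightarrow> real"
  assumes "a \<le> b"
    and "continuous_on {a..b} f"
    and "f ` {a..b} \<subseteq> {a..b}"
    and "topological_entropy {a..b} f = 0"
  shows "minimally_mean_attractable {a..b} f \<and> minimally_mean_L_stable {a..b} f"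
proof -
  interpret interval_map a b f using assms by unfold_locales
  have "horseshoe_free a b f" by (rule horseshoe_free_if_zero_entropy[OF interval_map_axioms assms(4)])
  then show ?thesis using minimally_mean_attractable_if_horseshoe_free minimally_mean_L_stable_if_horseshoe_free by blast
qed

end
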